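(* Let $S$ be a densely defined, closed, symmetric operator in a Hilbert space $\mathcal H$ and let $\{\mathcal G,\Gamma_0,\Gamma_1\}$ be a quasi boundary triple for $T\subset S^*$ with corresponding Weyl function $M$; let $A_0=T\upharpoonright\ker\Gamma_0$ and $A_1=T\upharpoonright\ker\Gamma_1$. Assume that $A_0$ is bounded from below and that $M(\lambda)$ is bounded for one (and hence for all) $\lambda\in\rho(A_0)$. Let $B$ be a self-adjoint operator in $\mathcal G$ which is bounded from above and assume that the following conditions are satisfied: (i) $\|\overline{M(\lambda)}\|\to0$ as $\lambda\to-\infty$; (ii) $\operatorname{ran}\overline{M(\lambda)}^{1/2}\subset\operatorname{dom}B$ for all $\lambda<\min\sigma(A_0)$; (iii) $B\bigl(\operatorname{ran}\overline{M(\lambda)}\bigr)\subset\operatorname{ran}\Gamma_0$ for all $\lambda<\min\sigma(A_0)$; (iv) $\operatorname{ran}\Gamma_1\subset\operatorname{dom}B$; (v) $B(\operatorname{ran}\Gamma_1)\subset\operatorname{ran}\Gamma_0$, or $A_1$ is self-adjoint and bounded from below; and assume that there exist $\alpha\in(0,1]$, $\mu\le\min\sigma(A_0)$ and $C>0$ such that $$\bigl\|\overline{M(\lambda)}\bigr\|\le\frac{C}{(\mu-\lambda)^\alpha}\qquad\text{for all }\lambda<\mu. \qquad( * )$$ Then the operators $$A_{[\omega B]}f=Tf,\qquad \operatorname{dom}A_{[\omega B]}=\bigl\{f\in\operatorname{dom}T:\Gamma_0f=\omega B\Gamma_1f\bigr\},\qquad\omega\ge0,$$ are self-adjoint extensions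 of $S$, which are bounded from below. Define $F(\omega):=\min\sigma(A_0)-\min\sigma(A_{[\omega B]})$ and let $F^+:=\max\{F,0\}$ be its positive part. Then: (a) $\bigl|\min\sigma(A_{[\omega B]})\bigr|=\mathcal O(|\omega|^{1/\alpha})$ as $\omega\to+\infty$; (b) if the bound $( * )$ holds for $\mu=\min\sigma(A_0)$, then $F^+(\omega)=\mathcal O(|\omega|^{1/\alpha})$ as $\omega\to0+$.
   Context: Let $S$ be a densely defined, closed, symmetric operator in $\mathcal H$, and let $T\subset S^*$ be a linear operator with $\overline T=S^*$. A triple $\{\mathcal G,\Gamma_0,\Gamma_1\}$ is a quasi boundary triple for $T\subset S^*$ if $\mathcal G$ is a Hilbert space and $\Gamma_0,\Gamma_1:\operatorname{dom}T\to\mathcal G$ are linear maps such that: (1) $(Tf,g)-(f,Tg)=(\Gamma_1f,\Gamma_0g)-(\Gamma_0f,\Gamma_1g)$ for all $f,g\in\operatorname{dom}T$; (2) $(\Gamma_0,\Gamma_1)^\top:\operatorname{dom}T\to\mathcal G\times\mathcal G$ has dense range; (3) $A_0:=T\upharpoonright\ker\Gamma_0$ is self-adjoint in $\mathcal H$. Put $A_1:=T\upharpoonright\ker\Gamma_1$ (not necessarily self-adjoint). For $\lambda\in\rho(A_0)$ one has $\operatorname{dom}T=\ker\Gamma_0\,\dot+\,\ker(T-\lambda)$, so $\Gamma_0\upharpoonright\ker(T-\lambda)$ is injective with range $\operatorname{ran}\Gamma_0$. The $\gamma$-field is $\gamma(\lambda):=(\Gamma_0\upharpoonright\ker(T-\lambda))^{-1}$,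 and the Weyl function is $M(\lambda):=\Gamma_1\gamma(\lambda)$, an operator in $\mathcal G$ with domain $\operatorname{ran}\Gamma_0$, $\lambda\in\rho(A_0)$. One has $M(\lambda)\subset M(\overline\lambda)^*$, so $M(\lambda)$ is closable; $\overline{M(\lambda)}$ denotes its closure. If $M(\lambda_0)$ is bounded for one $\lambda_0\in\rho(A_0)$, then $M(\lambda)$ is bounded for all $\lambda\in\rho(A_0)$. If $A_0$ is bounded from below and $\|\overline{M(\lambda)}\|\to0$ as $\lambda\to-\infty$, then $\overline{M(\lambda)}$ is a bounded non-negative self-adjoint operator for each $\lambda<\min\sigma(A_0)$, so that $\overline{M(\lambda)}^{1/2}$ is well defined. *)

theory Defs
  imports "HOL-Analysis.Analysis" "HOL-Library.Landau_Symbols"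
begin

section \<open>Complex Hilbert spaces\<close>

text \<open>
  A complex Hilbert space, built on top of the real one given by the real part of its inner
  product, so that norm, topology and completeness are those of the library.  The inner product
  is linear in its first argument.
\<close>

class complex_hilbert_space = real_inner + complete_space +
  fixes scaleC :: "complex \<Rightarrow> 'a \<Rightarrow> 'a" (infixr "*\<^sub>C" 75)
    and cinner :: "'a \<Rightarrow> 'a \<Rightarrow> complex"
  assumes scaleC_add_right: "c *\<^sub>C (x + y) = c *\<^sub>C x + c *\<^sub>C y"
    and scaleC_add_left: "(c + d) *\<^sub>C x = c *\<^sub>C x + d *\<^sub>C x"
    and scaleC_scaleC: "c *\<^sub>C d *\<^sub>C x = (c * d) *\<^sub>C x"
    and scaleC_of_real: "complex_of_real r *\<^sub>C x = r *\<^sub>R x"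
    and cinner_commute: "cinner x y = cnj (cinner y x)"
    and cinner_add_left: "cinner (x + y) z = cinner x z + cinner y z"
    and cinner_scaleC_left: "cinner (c *\<^sub>C x) y = c * cinner x y"
    and Re_cinner: "Re (cinner x y) = inner x y"

instantiation complex :: complex_hilbert_space
begin

definition scaleC_complex :: "complex \<Rightarrow> complex \<Rightarrow> complex" where
  "scaleC_complex c x = c * x"

definition cinner_complex :: "complex \<Rightarrow> complex \<Rightarrow> complex" where
  "cinner_complex x y = x * cnj y"

instance
  by standard
    (simp_all add: scaleC_complex_def cinner_complex_def algebra_simps scaleR_conv_of_real
      inner_complex_def)

end

section \<open>Linear operators\<close>

text \<open>
  A (possibly unbounded, not necessarily everywhere defined) operator is represented by its graph,
  so \<open>A \<subseteq> B\<close> says that \<open>B\<close> extends \<open>A\<close>, \<^term>\<open>Domain A\<close> and \<^term>\<open>Range A\<close> are the domain and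
  the range, \<^term>\<open>A\<inverse>\<close> is the inverse, \<^term>\<open>A `` X\<close> is the image of \<open>X\<close>, and the closure of an
  operator is the topological closure of its graph.
\<close>

type_synonym ('a, 'b) graph = "('a \<times> 'b) set"

definition linear_operator ::
  "('a::complex_hilbert_space, 'b::complex_hilbert_space) graph \<Rightarrow> bool" where
  "linear_operator A \<longleftrightarrow> single_valued A \<and> (0, 0) \<in> A \<and>
     (\<forall>(x, y)\<in>A. \<forall>(x', y')\<in>A. (x + x', y + y') \<in> A) \<and>
     (\<forall>c. \<forall>(x, y)\<in>A. (c *\<^sub>C x, c *\<^sub>C y) \<in> A)"

definition densely_defined ::
  "('a::complex_hilbert_space, 'b::complex_hilbert_space) graph \<Rightarrow> bool" where
  "densely_defined A \<longleftrightarrow> closure (Domain A) = UNIV"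

definition bounded_operator ::
  "('a::complex_hilbert_space, 'b::complex_hilbert_space) graph \<Rightarrow> bool" where
  "bounded_operator A \<longleftrightarrow> (\<exists>c. \<forall>(x, y)\<in>A. norm y \<le> c * norm x)"

text \<open>The operator norm, as in \<^const>\<open>onorm\<close>; only meaningful for bounded operators.\<close>

definition operator_norm ::
  "('a::complex_hilbert_space, 'b::complex_hilbert_space) graph \<Rightarrow> real" where
  "operator_norm A = (SUP (x, y)\<in>A. norm y / norm x)"

definition adjoint_operator ::
  "('a::complex_hilbert_space, 'b::complex_hilbert_space) graph \<Rightarrow> ('b, 'a) graph" where
  "adjoint_operator A = {(g, h). \<forall>(x, y)\<in>A. cinner y g = cinner x h}"

definition symmetric_operator :: "('a::complex_hilbert_space, 'a) graph \<Rightarrow> bool" where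
  "symmetric_operator A \<longleftrightarrow>
     linear_operator A \<and> densely_defined A \<and> A \<subseteq> adjoint_operator A"

definition selfadjoint_operator :: "('a::complex_hilbert_space, 'a) graph \<Rightarrow> bool" where
  "selfadjoint_operator A \<longleftrightarrow>
     linear_operator A \<and> densely_defined A \<and> A = adjoint_operator A"

text \<open>
  Semiboundedness is only used for symmetric operators, for which \<^term>\<open>cinner y x\<close> is real
  whenever \<open>(x, y)\<close> is in the graph.
\<close>

definition bounded_from_below :: "('a::complex_hilbert_space, 'a) graph \<Rightarrow> bool" where
  "bounded_from_below A \<longleftrightarrow> (\<exists>c::real. \<forall>(x, y)\<in>A. c * (norm x)\<^sup>2 \<le> Re (cinner y x))"

definition bounded_from_above :: "('a::complex_hilbert_space, 'a) graph \<Rightarrow> bool" where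
  "bounded_from_above A \<longleftrightarrow> (\<exists>c::real. \<forall>(x, y)\<in>A. Re (cinner y x) \<le> c * (norm x)\<^sup>2)"

definition nonnegative_operator :: "('a::complex_hilbert_space, 'a) graph \<Rightarrow> bool" where
  "nonnegative_operator A \<longleftrightarrow> (\<forall>(x, y)\<in>A. 0 \<le> Re (cinner y x))"

text \<open>
  The square root of a non-negative self-adjoint operator: the unique non-negative self-adjoint
  operator whose square is the given one.
\<close>

definition sqrt_operator ::
  "('a::complex_hilbert_space, 'a) graph \<Rightarrow> ('a, 'a) graph" where
  "sqrt_operator A = (THE R. selfadjoint_operator R \<and> nonnegative_operator R \<and> R O R = A)"

definition scale_operator ::
  "complex \<Rightarrow> ('a, 'b::complex_hilbert_space) graph \<Rightarrow> ('a, 'b) graph" where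
  "scale_operator c A = {(x, c *\<^sub>C y) | x y. (x, y) \<in> A}"

definition shift_operator ::
  "('a::complex_hilbert_space, 'a) graph \<Rightarrow> complex \<Rightarrow> ('a, 'a) graph" where
  "shift_operator A l = {(x, y - l *\<^sub>C x) | x y. (x, y) \<in> A}"

definition kernel :: "('a, 'b::zero) graph \<Rightarrow> 'a set" where
  "kernel A = {x. (x, 0) \<in> A}"

definition restrict_operator :: "('a, 'b) graph \<Rightarrow> 'a set \<Rightarrow> ('a, 'b) graph" where
  "restrict_operator A X = {(x, y) \<in> A. x \<in> X}"

definition resolvent_set :: "('a::complex_hilbert_space, 'a) graph \<Rightarrow> complex set" where
  "resolvent_set A = {l. single_valued ((shift_operator A l)\<inverse>) \<and>
     Domain ((shift_operator A l)\<inverse>) = UNIV \<and> bounded_operator ((shift_operator A l)\<inverse>)}"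

definition spectrum :: "('a::complex_hilbert_space, 'a) graph \<Rightarrow> complex set" where
  "spectrum A = - resolvent_set A"

text \<open>
  The minimum of the spectrum.  It exists for every self-adjoint operator that is bounded from
  below, unless the space is trivial (then the spectrum is empty, and this is some fixed number).
\<close>

definition min_spectrum :: "('a::complex_hilbert_space, 'a) graph \<Rightarrow> real" where
  "min_spectrum A = (LEAST r. complex_of_real r \<in> spectrum A)"

section \<open>Quasi boundary triples\<close>

text \<open>
  The boundary maps \<open>\<Gamma>\<^sub>0\<close> and \<open>\<Gamma>\<^sub>1\<close> are total functions in HOL, but only their values on
  \<^term>\<open>Domain T\<close> are ever used.
\<close>

definition linear_map_on ::
  "'a::complex_hilbert_space set \<Rightarrow> ('a \<Rightarrow> 'b::complex_hilbert_space) \<Rightarrow> bool" where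
  "linear_map_on X F \<longleftrightarrow> (\<forall>x\<in>X. \<forall>y\<in>X. F (x + y) = F x + F y) \<and>
     (\<forall>c. \<forall>x\<in>X. F (c *\<^sub>C x) = c *\<^sub>C F x)"

definition bdry_kernel_restriction ::
  "('h, 'h) graph \<Rightarrow> ('h \<Rightarrow> 'g::zero) \<Rightarrow> ('h, 'h) graph" where
  "bdry_kernel_restriction T \<Gamma> = restrict_operator T {f \<in> Domain T. \<Gamma> f = 0}"

definition quasi_boundary_triple ::
  "('h::complex_hilbert_space, 'h) graph \<Rightarrow> ('h, 'h) graph \<Rightarrow>
   ('h \<Rightarrow> 'g::complex_hilbert_space) \<Rightarrow> ('h \<Rightarrow> 'g) \<Rightarrow> bool" where
  "quasi_boundary_triple S T \<Gamma>0 \<Gamma>1 \<longleftrightarrow>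
     linear_operator T \<and> T \<subseteq> adjoint_operator S \<and> closure T = adjoint_operator S \<and>
     linear_map_on (Domain T) \<Gamma>0 \<and> linear_map_on (Domain T) \<Gamma>1 \<and>
     (\<forall>(f, Tf)\<in>T. \<forall>(g, Tg)\<in>T.
        cinner Tf g - cinner f Tg = cinner (\<Gamma>1 f) (\<Gamma>0 g) - cinner (\<Gamma>0 f) (\<Gamma>1 g)) \<and>
     closure ((\<lambda>f. (\<Gamma>0 f, \<Gamma>1 f)) ` Domain T) = UNIV \<and>
     selfadjoint_operator (bdry_kernel_restriction T \<Gamma>0)"

text \<open>
  \<open>\<gamma>(l)\<close> is the inverse of the restriction of \<open>\<Gamma>\<^sub>0\<close> to \<open>ker (T - l)\<close>, and \<open>M(l) = \<Gamma>\<^sub>1 \<gamma>(l)\<close>.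
  Both are operators when \<open>l\<close> is in the resolvent set of \<open>A\<^sub>0\<close>.
\<close>

definition gamma_field ::
  "('h::complex_hilbert_space, 'h) graph \<Rightarrow> ('h \<Rightarrow> 'g::complex_hilbert_space) \<Rightarrow> complex \<Rightarrow>
   ('g, 'h) graph" where
  "gamma_field T \<Gamma>0 l = {(f, \<Gamma>0 f) | f. f \<in> kernel (shift_operator T l)}\<inverse>"

definition weyl_function ::
  "('h::complex_hilbert_space, 'h) graph \<Rightarrow> ('h \<Rightarrow> 'g::complex_hilbert_space) \<Rightarrow> ('h \<Rightarrow> 'g) \<Rightarrow>
   complex \<Rightarrow> ('g, 'g) graph" where
  "weyl_function T \<Gamma>0 \<Gamma>1 l = {(\<phi>, \<Gamma>1 f) | \<phi> f. (\<phi>, f) \<in> gamma_field T \<Gamma>0 l}"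

text \<open>
  The operator \<open>A\<^bsub>[B]\<^esub>\<close>, i.e. the restriction of \<open>T\<close> to those \<open>f\<close> with \<open>\<Gamma>\<^sub>1 f \<in> dom B\<close> and
  \<open>\<Gamma>\<^sub>0 f = B \<Gamma>\<^sub>1 f\<close>.
\<close>

definition boundary_extension ::
  "('h, 'h) graph \<Rightarrow> ('h \<Rightarrow> 'g) \<Rightarrow> ('h \<Rightarrow> 'g) \<Rightarrow> ('g, 'g) graph \<Rightarrow> ('h, 'h) graph" where
  "boundary_extension T \<Gamma>0 \<Gamma>1 B = restrict_operator T {f \<in> Domain T. (\<Gamma>1 f, \<Gamma>0 f) \<in> B}"

end

theory Submission
  imports Defs
begin

text \<open>
  For real \<open>l\<close> below \<open>m = min \<sigma>(A0)\<close> the form of \<open>A0 - l\<close> extends to \<open>dom T\<close> by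
  \<open>t_l[f] = ((T - l) f, f) + (\<Gamma>0 f, \<Gamma>1 f)\<close>, and Green's identity makes it hermitian. Two facts
  about it carry the proof.

  The form \<open>t_l\<close> is non-negative (\<open>ref_form_nonneg\<close>). For \<open>k < l\<close> subtract from \<open>f\<close> the solution
  \<open>v\<close> of \<open>(T - k) v = 0\<close> with \<open>\<Gamma>0 v = \<Gamma>0 f\<close>. Then \<open>f - v \<in> dom A0\<close> contributes a non-negative
  amount, and the rest is bounded below, after completing a square in \<open>v\<close>, by a quantity that
  tends to \<open>0\<close> as \<open>k \<rightarrow> -\<infinity>\<close>, because \<open>\<parallel>M(k)\<parallel>\<close> does. Next, \<open>\<parallel>\<Gamma>1 f\<parallel>\<^sup>2 \<le> \<parallel>M(l)\<parallel> t_l[f]\<close>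
  (\<open>norm_\<Gamma>1_le_ref_form\<close>): this is the Cauchy-Schwarz inequality for \<open>t_l\<close> against \<open>\<gamma>(l)\<phi>\<close>, since
  \<open>t_l[f, \<gamma>(l)\<phi>] = (\<Gamma>1 f, \<phi>)\<close> and \<open>t_l[\<gamma>(l)\<phi>] = (M(l)\<phi>, \<phi>)\<close>.

  On the domain of the extension given by \<open>\<Gamma>0 f = B \<Gamma>1 f\<close> one has
  \<open>((T - l) f, f) = t_l[f] - (B \<Gamma>1 f, \<Gamma>1 f)\<close>. If \<open>B \<le> b\<close>, the subtracted term is at most
  \<open>b \<parallel>M(l)\<parallel> t_l[f]\<close>, so the extension is bounded below by \<open>l\<close> as soon as \<open>b \<parallel>M(l)\<parallel> \<le> 1\<close>
  (\<open>ext_form_bound\<close>). For \<open>\<omega> B\<close> and the assumed decay of \<open>M\<close> this holds for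
  \<open>l = \<mu> - (\<omega> b C) powr (1 / \<alpha>)\<close>, which is of the required order in \<open>\<omega>\<close>, and with \<open>\<mu> = m\<close> it
  bounds \<open>m - min \<sigma>\<close> of the extension for small \<open>\<omega>\<close> as well. An upper bound for the bottom of the
  spectrum comes from a fixed vector of \<open>dom S\<close>, which lies in the domain of every extension.

  For self-adjointness it suffices that the symmetric extension minus some real \<open>l\<close> is onto
  (\<open>ext_shift_onto\<close>). By Krein's ansatz this means solving \<open>\<phi> = B M(l) \<phi> + B \<psi>\<close> with \<open>\<psi> \<in> ran \<Gamma>1\<close>.
  With \<open>R\<close> the square root of the closure of \<open>M(l)\<close>, the operator \<open>R B R\<close> is everywhere defined,
  symmetric and at most \<open>b \<parallel>M(l)\<parallel> < 1\<close>, so \<open>u = R B R u + R B \<psi>\<close> has a solution, and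
  \<open>\<phi> = B R u + B \<psi>\<close> is the one sought.

  These form estimates decide the spectral statements because the minimum of the spectrum of a
  self-adjoint operator is its largest form bound (\<open>le_min_spectrum_iff\<close>). The square root is
  accessible through its existence and uniqueness, which are obtained from an iteration
  (\<open>sqrt_operator_graph\<close>).

  Since \<open>Re (x, y)\<close> is the real inner product, and the imaginary part of \<open>(x, y)\<close> is recovered
  from it by multiplying \<open>x\<close> by \<open>\<i>\<close>, all estimates are carried out with the real inner product.
\<close>

section \<open>Orthogonality, closed ranges and uniform boundedness\<close>

text \<open>
  The Cauchy-Schwarz inequality for a non-negative form along a line \<open>f + t u\<close>: \<open>a\<close>, \<open>h\<close> and \<open>b\<close>
  are its values at \<open>(f, f)\<close>, \<open>(f, u)\<close> and \<open>(u, u)\<close>.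
\<close>

lemma discriminant_le:
  fixes a b h :: real
  assumes "\<And>t. 0 \<le> a + 2 * t * h + t\<^sup>2 * b"
  shows "h\<^sup>2 \<le> a * b"
proof (cases "b = 0")
  case True
  \<comment> \<open>An affine function that is non-negative everywhere is constant.\<close>
  have "h = 0"
  proof (rule ccontr)
    assume "h \<noteq> 0"
    then have "a + 2 * (- (a + 1) / (2 * h)) * h = -1" by (simp add: field_simps)
    with assms[of "- (a + 1) / (2 * h)"] True show False by simp
  qed
  with True show ?thesis by simp
next
  case False
  have "b \<ge> 0"
  proof (rule ccontr)
    assume "\<not> b \<ge> 0"
    then have b: "b < 0" by simp
    \<comment> \<open>Averaging over t and -t removes h; this t is so large that \<open>a + t\<^sup>2 * b < 0\<close>.\<close>
    define t where "t = (\<bar>a\<bar> + 1) / (- b) + 1"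
    have t: "t \<ge> 1" using b unfolding t_def by (simp add: divide_nonneg_neg)
    have "0 \<le> (a + 2 * t * h + t\<^sup>2 * b) + (a + 2 * (- t) * h + (- t)\<^sup>2 * b)"
      by (intro add_nonneg_nonneg assms)
    then have "0 \<le> 2 * (a + t\<^sup>2 * b)" by (simp add: algebra_simps)
    then have "0 \<le> a + t\<^sup>2 * b" by (subst (asm) zero_le_mult_iff) auto
    moreover have "t\<^sup>2 * b \<le> t * b" using t b by (simp add: power2_eq_square)
    moreover have "t * b = - (\<bar>a\<bar> + 1) + b" using b by (simp add: t_def field_simps)
    ultimately show False using b by linarith
  qed
  with False have b: "b > 0" by simp
  \<comment> \<open>The minimum of the quadratic polynomial is attained at \<open>t = - h / b\<close>.\<close>
  have "0 \<le> a + 2 * (- h / b) * h + (- h / b)\<^sup>2 * b" by (rule assms)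
  also have "\<dots> = a - h\<^sup>2 / b" using b by (simp add: field_simps power2_eq_square)
  finally show ?thesis using b by (simp add: field_simps)
qed

text \<open>
  The projection theorem: by the parallelogram identity a minimising sequence for the distance
  from \<open>x\<close> to \<open>V\<close> is Cauchy, and \<open>x\<close> minus its limit is orthogonal to \<open>V\<close>.
\<close>

lemma closed_subspace_eq_UNIV:
  fixes V :: "'a::{real_inner,complete_space} set"
  assumes V: "subspace V" "closed V"
    and orth: "\<And>z. (\<And>v. v \<in> V \<Longrightarrow> inner v z = 0) \<Longrightarrow> z = 0"
  shows "V = UNIV"
proof -
  have "x \<in> V" for x
  proof -
    define d where "d = infdist x V"
    have ne: "V \<noteq> {}" using V(1) subspace_0 by auto
    have d0: "d \<ge> 0" by (simp add: d_def infdist_nonneg)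
    have dle: "d \<le> norm (x - v)" if "v \<in> V" for v
      using infdist_le[OF that, of x] by (simp add: d_def dist_norm)
    have "\<exists>v\<in>V. norm (x - v) < d + inverse (real (Suc n))" for n
    proof (rule ccontr)
      assume "\<not> ?thesis"
      then have "d + inverse (real (Suc n)) \<le> infdist x V"
        unfolding infdist_notempty[OF ne]
        by (intro cINF_greatest[OF ne]) (auto simp: dist_norm not_less)
      then show False by (simp add: d_def)
    qed
    then obtain v where v: "\<And>n. v n \<in> V" "\<And>n. norm (x - v n) < d + inverse (real (Suc n))"
      by metis
    have lim: "(\<lambda>n. norm (x - v n)) \<longlonglongrightarrow> d"
    proof (rule real_tendsto_sandwich)
      show "\<forall>\<^sub>F n in sequentially. d \<le> norm (x - v n)" using dle v(1) by auto
      show "\<forall>\<^sub>F n in sequentially. norm (x - v n) \<le> d + inverse (real (Suc n))"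
        using v(2) by (intro always_eventually allI less_imp_le)
      show "(\<lambda>n. d + inverse (real (Suc n))) \<longlonglongrightarrow> d"
        using tendsto_add[OF tendsto_const LIMSEQ_inverse_real_of_nat] by simp
    qed simp
    have par: "(norm (v m - v n))\<^sup>2 \<le> 2 * (norm (x - v m))\<^sup>2 + 2 * (norm (x - v n))\<^sup>2 - 4 * d\<^sup>2" for m n
    proof -
      have "(1/2) *\<^sub>R (v m + v n) \<in> V" using V v by (simp add: subspace_add subspace_scale)
      then have "d\<^sup>2 \<le> (norm (x - (1/2) *\<^sub>R (v m + v n)))\<^sup>2" using dle d0 by (simp add: power_mono)
      moreover have "(norm (v m - v n))\<^sup>2 + 4 * (norm (x - (1/2) *\<^sub>R (v m + v n)))\<^sup>2
          = 2 * (norm (x - v m))\<^sup>2 + 2 * (norm (x - v n))\<^sup>2"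
        by (simp add: power2_norm_eq_inner inner_simps inner_commute algebra_simps)
      ultimately show ?thesis by linarith
    qed
    have "Cauchy v"
    proof (rule metric_CauchyI)
      fix e :: real assume e: "e > 0"
      have "(\<lambda>n. (norm (x - v n))\<^sup>2) \<longlonglongrightarrow> d\<^sup>2" by (intro tendsto_intros lim)
      then have "\<forall>\<^sub>F n in sequentially. (norm (x - v n))\<^sup>2 < d\<^sup>2 + e\<^sup>2 / 4"
        using e by (intro order_tendstoD) auto
      then obtain N where N: "\<And>n. n \<ge> N \<Longrightarrow> (norm (x - v n))\<^sup>2 < d\<^sup>2 + e\<^sup>2 / 4"
        by (auto simp: eventually_sequentially)
      have "dist (v m) (v n) < e" if "m \<ge> N" "n \<ge> N" for m n
      proof -
        have "(norm (v m - v n))\<^sup>2 < e\<^sup>2" using par[of m n] N[OF that(1)] N[OF that(2)] by linarith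
        then show ?thesis using e by (simp add: dist_norm power2_less_imp_less)
      qed
      then show "\<exists>M. \<forall>m\<ge>M. \<forall>n\<ge>M. dist (v m) (v n) < e" by blast
    qed
    then obtain w where w: "v \<longlonglongrightarrow> w" using Cauchy_convergent convergent_def by blast
    have wV: "w \<in> V" using closed_sequentially[OF V(2) _ w] v(1) by auto
    have nw: "norm (x - w) = d"
      using LIMSEQ_unique[OF lim tendsto_norm[OF tendsto_diff[OF tendsto_const w]]] by simp
    have "x - w = 0"
    proof (rule orth)
      fix u assume u: "u \<in> V"
      have "0 \<le> 0 + 2 * t * inner u (x - w) + t\<^sup>2 * inner u u" for t
      proof -
        have "w - t *\<^sub>R u \<in> V" using V wV u by (simp add: subspace_diff subspace_scale)
        then have "d\<^sup>2 \<le> (norm (x - (w - t *\<^sub>R u)))\<^sup>2" using dle d0 by (simp add: power_mono)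
        also have "\<dots> = (norm (x - w))\<^sup>2 + (2 * t * inner u (x - w) + t\<^sup>2 * inner u u)"
          by (simp only: power2_norm_eq_inner)
            (simp add: inner_simps inner_commute algebra_simps power2_eq_square)
        finally show ?thesis by (simp add: nw)
      qed
      then show "inner u (x - w) = 0" using discriminant_le[of 0 "inner u (x - w)" "inner u u"] by simp
    qed
    with wV show ?thesis by simp
  qed
  then show ?thesis by auto
qed

text \<open>
  The lower bound makes preimages of Cauchy sequences Cauchy, so that the range of a closed
  relation is closed; it is everything once nothing non-zero is orthogonal to it.
\<close>

lemma coercive_relation_onto:
  fixes L :: "('a::{real_inner,complete_space} \<times> 'b::{real_inner,complete_space}) set"
  assumes L: "subspace L" "closed L"
    and c: "c > 0" "\<And>x y. (x, y) \<in> L \<Longrightarrow> c * norm x \<le> norm y"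
    and dense: "\<And>z. (\<And>x y. (x, y) \<in> L \<Longrightarrow> inner y z = 0) \<Longrightarrow> z = 0"
  shows "Range L = UNIV"
proof (rule closed_subspace_eq_UNIV)
  have "subspace (snd ` L)" using L(1) by (intro linear_subspace_image) (auto intro: linearI)
  then show "subspace (Range L)" by (simp add: Range_snd)
  show "closed (Range L)"
  proof (unfold closed_sequential_limits, intro allI impI, elim conjE)
    fix y l assume y: "\<forall>n. y n \<in> Range L" "y \<longlonglongrightarrow> l"
    then obtain x where x: "\<And>n. (x n, y n) \<in> L" unfolding Range_iff by metis
    have le: "c * norm (x m - x n) \<le> norm (y m - y n)" for m n
      using c(2)[of "x m - x n" "y m - y n"] subspace_diff[OF L(1) x[of m] x[of n]] by simp
    have "Cauchy x"
    proof (rule metric_CauchyI)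
      fix e :: real assume "e > 0"
      then have "c * e > 0" using c by simp
      then obtain N where N: "\<And>m n. m \<ge> N \<Longrightarrow> n \<ge> N \<Longrightarrow> dist (y m) (y n) < c * e"
        using LIMSEQ_imp_Cauchy[OF y(2)] unfolding Cauchy_def by meson
      have "dist (x m) (x n) < e" if "m \<ge> N" "n \<ge> N" for m n
        using le[of m n] N[OF that] c(1) unfolding dist_norm
        by (meson le_less_trans mult_less_cancel_left_pos)
      then show "\<exists>M. \<forall>m\<ge>M. \<forall>n\<ge>M. dist (x m) (x n) < e" by blast
    qed
    then obtain u where u: "x \<longlonglongrightarrow> u" using Cauchy_convergent convergent_def by blast
    have "(u, l) \<in> L"
      using closed_sequentially[OF L(2) _ tendsto_Pair[OF u y(2)]] x by auto
    then show "l \<in> Range L" by auto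
  qed
  show "z = 0" if "\<And>v. v \<in> Range L \<Longrightarrow> inner v z = 0" for z
    by (rule dense, rule that) auto
qed

text \<open>
  The uniform boundedness principle, obtained from the Baire category theorem: one of the closed
  sets \<open>E n\<close> of vectors that act as functionals bounded by \<open>n\<close> on \<open>X\<close> contains a ball, and moving
  from its centre in the direction of \<open>f \<in> X\<close> bounds \<open>norm f\<close>.
\<close>

lemma weakly_bounded_imp_bounded:
  fixes X :: "'a::{real_inner,complete_space} set"
  assumes "\<And>h. \<exists>c. \<forall>f\<in>X. \<bar>inner f h\<bar> \<le> c"
  shows "\<exists>c. \<forall>f\<in>X. norm f \<le> c"
proof -
  define E where "E n = {h. \<forall>f\<in>X. \<bar>inner f h\<bar> \<le> real n}" for n :: nat
  have cl: "closed (E n)" for n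
  proof -
    have "E n = (\<Inter>f\<in>X. {h. \<bar>inner f h\<bar> \<le> real n})" by (auto simp: E_def)
    then show ?thesis by (auto intro!: closed_INT closed_Collect_le continuous_intros)
  qed
  have "h \<in> \<Union>(range E)" for h
  proof -
    obtain c where "\<forall>f\<in>X. \<bar>inner f h\<bar> \<le> c" using assms by blast
    moreover obtain n where "c \<le> real n" using real_arch_simple by blast
    ultimately have "h \<in> E n" unfolding E_def by fastforce
    then show ?thesis by blast
  qed
  then have un: "\<Union>(range E) = UNIV" by blast
  have "\<exists>n. interior (E n) \<noteq> {}"
  proof (rule ccontr)
    assume "\<nexists>n. interior (E n) \<noteq> {}"
    then have "euclidean interior_of \<Union>(range E) = {}"
      using cl completely_metrizable_space_euclidean by (intro Baire_category_alt) auto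
    then show False by (simp add: un)
  qed
  then obtain n h where "h \<in> interior (E n)" by blast
  then obtain e where e: "e > 0" "ball h e \<subseteq> E n" using mem_interior by blast
  have "norm f \<le> 4 * real n / e" if f: "f \<in> X" for f
  proof (cases "f = 0")
    case False
    define k where "k = h + (e / 2 / norm f) *\<^sub>R f"
    have "dist h k < e" using e False by (simp add: k_def dist_norm)
    then have "k \<in> E n" "h \<in> E n" using e by auto
    then have "\<bar>inner f k\<bar> \<le> real n" "\<bar>inner f h\<bar> \<le> real n" using f by (auto simp: E_def)
    moreover have "inner f k - inner f h = e / 2 * norm f"
      using False by (simp add: k_def inner_simps power2_norm_eq_inner[symmetric] power2_eq_square)
    ultimately have "e / 2 * norm f \<le> 2 * real n" by linarith
    then show ?thesis using e by (simp add: field_simps)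
  qed (use e in auto)
  then show ?thesis by blast
qed

text \<open>
  Symmetric in the sense of real Hilbert spaces. Such an everywhere defined map is automatically
  linear and has a closed graph, because \<open>inner (K x) z\<close> is determined by \<open>inner x (K z)\<close> for all
  \<open>z\<close>.
\<close>

definition symmetric_map :: "('a::real_inner \<Rightarrow> 'a) \<Rightarrow> bool" where
  "symmetric_map K \<longleftrightarrow> (\<forall>x y. inner (K x) y = inner x (K y))"

lemma symmetric_mapD: "symmetric_map K \<Longrightarrow> inner (K x) y = inner x (K y)"
  by (simp add: symmetric_map_def)

lemma inner_ext: "(\<And>z. inner x z = inner y z) \<Longrightarrow> x = y" for x y :: "'a::real_inner"
  by (metis inner_diff_left inner_eq_zero_iff right_minus_eq)

lemma symmetric_map_linear:
  assumes K: "symmetric_map K"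
  shows "linear K"
  by (rule linearI; rule inner_ext)
    (simp_all add: inner_simps symmetric_mapD[OF K])

lemma symmetric_map_closed:
  assumes K: "symmetric_map K" and lim: "X \<longlonglongrightarrow> x" "(\<lambda>n. K (X n)) \<longlonglongrightarrow> y"
  shows "K x = y"
proof (rule inner_ext)
  fix z
  have "(\<lambda>n. inner (K (X n)) z) \<longlonglongrightarrow> inner y z" by (intro tendsto_intros lim)
  moreover have "(\<lambda>n. inner (X n) (K z)) \<longlonglongrightarrow> inner x (K z)" by (intro tendsto_intros lim)
  ultimately show "inner (K x) z = inner y z"
    using LIMSEQ_unique by (simp add: symmetric_mapD[OF K])
qed

text \<open>
  If \<open>K \<le> q < 1\<close>, then \<open>1 - K\<close> is bounded below by \<open>1 - q\<close> and, being symmetric and injective, has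
  no non-zero vector orthogonal to its range. The graph of \<open>K\<close> is closed, hence so is that of
  \<open>1 - K\<close>.
\<close>

lemma symmetric_map_coercive_onto:
  fixes K :: "'a::{real_inner,complete_space} \<Rightarrow> 'a"
  assumes K: "symmetric_map K" and q: "q < 1" "\<And>x. inner (K x) x \<le> q * (norm x)\<^sup>2"
  shows "\<exists>x. x - K x = y"
proof -
  note lin = symmetric_map_linear[OF K]
  let ?L = "range (\<lambda>x. (x, x - K x))"
  have coer: "(1 - q) * (norm x)\<^sup>2 \<le> inner (x - K x) x" for x
    using q(2)[of x] by (simp add: inner_simps power2_norm_eq_inner algebra_simps)
  have "Range ?L = UNIV"
  proof (rule coercive_relation_onto)
    show "subspace ?L"
      by (rule linear_subspace_image)
        (auto intro!: linearI simp: linear_add[OF lin] linear_scale[OF lin] algebra_simps)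
    show "closed ?L"
    proof (unfold closed_sequential_limits, intro allI impI, elim conjE)
      fix p l assume p: "\<forall>n. p n \<in> ?L" "p \<longlonglongrightarrow> l"
      then have e: "p n = (fst (p n), fst (p n) - K (fst (p n)))" for n
        by (metis (no_types, lifting) fst_conv rangeE)
      have 1: "(\<lambda>n. fst (p n)) \<longlonglongrightarrow> fst l" by (intro tendsto_intros p)
      have "(\<lambda>n. fst (p n) - snd (p n)) \<longlonglongrightarrow> fst l - snd l" by (intro tendsto_intros p)
      moreover have "fst (p n) - snd (p n) = K (fst (p n))" for n
        by (subst (2) e) simp
      ultimately have "K (fst l) = fst l - snd l" using symmetric_map_closed[OF K 1] by simp
      then have "l = (fst l, fst l - K (fst l))" by (simp add: prod_eq_iff)
      then show "l \<in> ?L" by blast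
    qed
    show "0 < 1 - q" using q by simp
    show "(1 - q) * norm x \<le> norm y" if "(x, y) \<in> ?L" for x y
    proof (cases "x = 0")
      case False
      have "(1 - q) * norm x * norm x \<le> norm y * norm x"
        using coer[of x] norm_cauchy_schwarz[of y x] that by (auto simp: power2_eq_square algebra_simps)
      then show ?thesis using False by simp
    qed simp
    show "z = 0" if "\<And>x y. (x, y) \<in> ?L \<Longrightarrow> inner y z = 0" for z
    proof -
      have "inner (z - K z) z = 0" using that by blast
      then have "(1 - q) * (norm z)\<^sup>2 \<le> 0" using coer[of z] by simp
      then show ?thesis using q by (simp add: mult_le_0_iff)
    qed
  qed
  then have "y \<in> Range ?L" by simp
  then show ?thesis by auto
qed

lemma nonneg_symmetric_map_cauchy_schwarz:
  assumes K: "symmetric_map K" and nn: "\<And>x. 0 \<le> inner (K x) x"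
  shows "((norm (K x))\<^sup>2)\<^sup>2 \<le> inner (K x) x * inner (K (K x)) (K x)"
proof (rule discriminant_le)
  note lin = symmetric_map_linear[OF K]
  fix t
  have "0 \<le> inner (K (x + t *\<^sub>R K x)) (x + t *\<^sub>R K x)" by (rule nn)
  also have "\<dots> = inner (K x) x + 2 * t * (norm (K x))\<^sup>2 + t\<^sup>2 * inner (K (K x)) (K x)"
    using symmetric_mapD[OF K, of "K x" x]
    unfolding power2_norm_eq_inner
    by (simp add: linear_add[OF lin] linear_scale[OF lin] inner_simps power2_eq_square algebra_simps)
  finally show "0 \<le> \<dots>" .
qed

text \<open>
  Cauchy-Schwarz for the form \<open>(K x, y)\<close>, tested with \<open>y = K x\<close>.
\<close>

lemma nonneg_symmetric_map_norm:
  assumes K: "symmetric_map K" and nn: "\<And>x. 0 \<le> inner (K x) x"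
    and b: "\<And>x. norm (K x) \<le> c * norm x"
  shows "(norm (K x))\<^sup>2 \<le> c * inner (K x) x"
proof (cases "K x = 0")
  case False
  have "inner (K (K x)) (K x) \<le> c * (norm (K x))\<^sup>2"
    using norm_cauchy_schwarz[of "K (K x)" "K x"] mult_right_mono[OF b[of "K x"] norm_ge_zero[of "K x"]]
    by (simp add: power2_eq_square algebra_simps)
  then have "inner (K x) x * inner (K (K x)) (K x) \<le> inner (K x) x * (c * (norm (K x))\<^sup>2)"
    using nn by (intro mult_left_mono)
  with nonneg_symmetric_map_cauchy_schwarz[OF K nn, of x]
  have "(norm (K x))\<^sup>2 * (norm (K x))\<^sup>2 \<le> (c * inner (K x) x) * (norm (K x))\<^sup>2"
    by (simp add: power2_eq_square algebra_simps)
  then show ?thesis using False by (subst (asm) mult_le_cancel_right) auto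
qed (use nn in auto)

lemma nonneg_symmetric_map_kernel:
  assumes K: "symmetric_map K" "\<And>x. 0 \<le> inner (K x) x" and z: "inner (K x) x = 0"
  shows "K x = 0"
  using nonneg_symmetric_map_cauchy_schwarz[OF K, of x] z by simp

section \<open>Square roots of bounded non-negative maps\<close>

text \<open>
  The iteration \<open>Y \<mapsto> (C + Y\<^sup>2) / 2\<close>, started at \<open>0\<close>, converges for a symmetric contraction \<open>C\<close> to
  a fixed point \<open>Y\<close>, and \<open>(1 - Y)\<^sup>2 = 1 - C\<close>. The same iteration for the number \<open>1\<close> in place of
  \<open>C\<close> dominates it in norm, since the iterates are polynomials in \<open>C\<close> with non-negative
  coefficients.
\<close>

primrec sqrt_iter :: "('a::real_normed_vector \<Rightarrow> 'a) \<Rightarrow> nat \<Rightarrow> 'a \<Rightarrow> 'a" where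
  "sqrt_iter C 0 x = 0"
| "sqrt_iter C (Suc n) x = (1/2) *\<^sub>R (C x + sqrt_iter C n (sqrt_iter C n x))"

primrec sqrt_iter_bound :: "nat \<Rightarrow> real" where
  "sqrt_iter_bound 0 = 0"
| "sqrt_iter_bound (Suc n) = (1 + (sqrt_iter_bound n)\<^sup>2) / 2"

lemma sqrt_iter_bound_range: "0 \<le> sqrt_iter_bound n \<and> sqrt_iter_bound n \<le> 1"
proof (induction n)
  case (Suc n)
  then have "(sqrt_iter_bound n)\<^sup>2 \<le> 1" by (simp add: power_le_one)
  then show ?case by simp
qed simp

lemma sqrt_iter_bound_mono: "sqrt_iter_bound n \<le> sqrt_iter_bound (Suc n)"
proof -
  have "0 \<le> (1 - sqrt_iter_bound n)\<^sup>2" by simp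
  then show ?thesis by (simp add: power2_eq_square algebra_simps)
qed

lemma sqrt_iter_symmetric:
  assumes C: "symmetric_map C"
  shows "symmetric_map (sqrt_iter C n)"
proof (induction n)
  case (Suc n)
  show ?case
    unfolding symmetric_map_def
    by (simp add: inner_simps symmetric_mapD[OF C] symmetric_mapD[OF Suc])
qed (simp add: symmetric_map_def)

lemma sqrt_iter_commute:
  assumes D: "linear D" "\<And>x. D (C x) = C (D x)"
  shows "D (sqrt_iter C n x) = sqrt_iter C n (D x)"
  by (induction n arbitrary: x) (simp_all add: D linear_0[OF D(1)] linear_add[OF D(1)] linear_scale[OF D(1)])

lemma sqrt_iter_norm:
  assumes b: "\<And>x. norm (C x) \<le> norm x"
  shows "norm (sqrt_iter C n x) \<le> sqrt_iter_bound n * norm x"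
proof (induction n arbitrary: x)
  case (Suc n)
  have "norm (sqrt_iter C n (sqrt_iter C n x)) \<le> sqrt_iter_bound n * (sqrt_iter_bound n * norm x)"
    using Suc[of x] Suc[of "sqrt_iter C n x"] sqrt_iter_bound_range[of n]
    by (meson mult_left_mono order_trans)
  with b[of x] norm_triangle_ineq[of "C x" "sqrt_iter C n (sqrt_iter C n x)"]
  have "norm (C x + sqrt_iter C n (sqrt_iter C n x)) \<le> (1 + (sqrt_iter_bound n)\<^sup>2) * norm x"
    by (simp add: power2_eq_square algebra_simps)
  then show ?case by simp
qed simp

text \<open>
  All iterates commute, so the difference of squares \<open>Z\<^sup>2 - Y\<^sup>2 = (Z + Y) (Z - Y)\<close> factors as it
  does for numbers, and the domination passes from one step to the next.
\<close>

lemma sqrt_iter_step_norm: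
  assumes C: "symmetric_map C" and b: "\<And>x. norm (C x) \<le> norm x"
  shows "norm (sqrt_iter C (Suc n) x - sqrt_iter C n x)
    \<le> (sqrt_iter_bound (Suc n) - sqrt_iter_bound n) * norm x"
proof (induction n arbitrary: x)
  case 0
  then show ?case using b[of x] by simp
next
  case (Suc n)
  let ?Y = "sqrt_iter C n" and ?Z = "sqrt_iter C (Suc n)"
  let ?y = "sqrt_iter_bound n" and ?z = "sqrt_iter_bound (Suc n)"
  note linY = symmetric_map_linear[OF sqrt_iter_symmetric[OF C, of n]]
  note linZ = symmetric_map_linear[OF sqrt_iter_symmetric[OF C, of "Suc n"]]
  have comm: "?Z (?Y x) = ?Y (?Z x)"
    by (intro sqrt_iter_commute[OF linZ])
      (rule sqrt_iter_commute[OF symmetric_map_linear[OF C], symmetric], simp)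
  define w where "w = ?Z x - ?Y x"
  have "sqrt_iter C (Suc (Suc n)) x - ?Z x = (1/2) *\<^sub>R (?Z (?Z x) - ?Y (?Y x))"
    by (simp only: sqrt_iter.simps(2)[of C "Suc n"]) (subst (3) sqrt_iter.simps(2), simp only: scaleR_diff_right scaleR_add_right, simp)
  also have "\<dots> = (1/2) *\<^sub>R (?Z w + ?Y w)"
    unfolding w_def linear_diff[OF linY] linear_diff[OF linZ] comm by simp
  also have "norm \<dots> \<le> 1/2 * (?z * norm w + ?y * norm w)"
    using sqrt_iter_norm[OF b, of "Suc n" w] sqrt_iter_norm[OF b, of n w] norm_triangle_ineq[of "?Z w" "?Y w"]
    by (simp del: sqrt_iter.simps sqrt_iter_bound.simps)
  also have "\<dots> = 1/2 * (?z + ?y) * norm w" by (simp add: algebra_simps)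
  also have "\<dots> \<le> 1/2 * (?z + ?y) * ((?z - ?y) * norm x)"
    using Suc[of x] sqrt_iter_bound_range[of n] sqrt_iter_bound_range[of "Suc n"]
    unfolding w_def by (intro mult_left_mono) auto
  also have "\<dots> = (sqrt_iter_bound (Suc (Suc n)) - ?z) * norm x"
  proof -
    have "sqrt_iter_bound (Suc (Suc n)) - ?z = (?z\<^sup>2 - ?y\<^sup>2) / 2"
      by (simp only: sqrt_iter_bound.simps(2)[of "Suc n"]) (simp add: field_simps)
    then show ?thesis by (simp only: power2_eq_square) (simp add: algebra_simps del: sqrt_iter_bound.simps)
  qed
  finally show ?case .
qed

text \<open>
  The increments are dominated by those of a bounded increasing sequence of numbers.
\<close>

lemma sqrt_iter_convergent:
  fixes C :: "'a::{real_inner,complete_space} \<Rightarrow> 'a"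
  assumes C: "symmetric_map C" and b: "\<And>x. norm (C x) \<le> norm x"
  shows "convergent (\<lambda>n. sqrt_iter C n x)"
proof -
  have diff: "norm (sqrt_iter C (m + k) x - sqrt_iter C m x)
      \<le> (sqrt_iter_bound (m + k) - sqrt_iter_bound m) * norm x" for m k
  proof (induction k)
    case (Suc k)
    have "sqrt_iter C (m + Suc k) x - sqrt_iter C m x =
        (sqrt_iter C (Suc (m + k)) x - sqrt_iter C (m + k) x) + (sqrt_iter C (m + k) x - sqrt_iter C m x)"
      by simp
    also have "norm \<dots> \<le> (sqrt_iter_bound (Suc (m + k)) - sqrt_iter_bound (m + k)) * norm x +
        (sqrt_iter_bound (m + k) - sqrt_iter_bound m) * norm x"
      by (intro norm_triangle_mono Suc sqrt_iter_step_norm[OF C b])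
    finally show ?case by (simp add: algebra_simps)
  qed simp
  have mono: "incseq sqrt_iter_bound" by (intro incseq_SucI sqrt_iter_bound_mono)
  have "convergent sqrt_iter_bound"
    using incseq_convergent[OF mono, of 1] sqrt_iter_bound_range convergentI by metis
  then have "convergent (\<lambda>n. sqrt_iter_bound n * norm x)" by (intro convergent_mult convergent_const)
  then have ca: "Cauchy (\<lambda>n. sqrt_iter_bound n * norm x)" by (rule convergent_Cauchy)
  have "Cauchy (\<lambda>n. sqrt_iter C n x)"
  proof (rule CauchyI')
    fix e :: real assume "e > 0"
    then obtain M where M: "\<And>m n. m \<ge> M \<Longrightarrow> n \<ge> M \<Longrightarrow>
        dist (sqrt_iter_bound m * norm x) (sqrt_iter_bound n * norm x) < e"
      using ca unfolding Cauchy_def by meson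
    have "dist (sqrt_iter C m x) (sqrt_iter C n x) < e" if "m \<ge> M" "m < n" for m n
    proof -
      have k: "n = m + (n - m)" using that by simp
      have "dist (sqrt_iter C m x) (sqrt_iter C n x) \<le> sqrt_iter_bound n * norm x - sqrt_iter_bound m * norm x"
        using diff[of m "n - m"] k by (simp add: dist_norm norm_minus_commute algebra_simps)
      also have "\<dots> \<le> dist (sqrt_iter_bound m * norm x) (sqrt_iter_bound n * norm x)"
        by (simp add: dist_real_def)
      also have "\<dots> < e" using M[of m n] that by simp
      finally show ?thesis .
    qed
    then show "\<exists>M. \<forall>m\<ge>M. \<forall>n>m. dist (sqrt_iter C m x) (sqrt_iter C n x) < e" by blast
  qed
  then show ?thesis by (rule Cauchy_convergent)
qed

definition nonneg_sqrt_map :: "('a::real_inner \<Rightarrow> 'a) \<Rightarrow> ('a \<Rightarrow> 'a) \<Rightarrow> bool" where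
  "nonneg_sqrt_map N R \<longleftrightarrow>
    symmetric_map R \<and> (\<forall>x. 0 \<le> inner (R x) x) \<and> (\<forall>x. R (R x) = N x)"

text \<open>
  With \<open>d \<ge> \<parallel>N\<parallel>\<close> the map \<open>C = 1 - N / d\<close> is a contraction, and the limit \<open>Y\<close> of the iteration
  yields the square root \<open>sqrt d * (1 - Y)\<close>. As a limit of polynomials in \<open>N\<close> it commutes with
  everything symmetric that commutes with \<open>N\<close>; this is what makes the square root unique.
\<close>

lemma nonneg_sqrt_map_exists_commuting:
  fixes N :: "'a::{real_inner,complete_space} \<Rightarrow> 'a"
  assumes N: "symmetric_map N" "\<And>x. 0 \<le> inner (N x) x" and b: "\<And>x. norm (N x) \<le> c * norm x"
  shows "\<exists>R. nonneg_sqrt_map N R \<and>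
    (\<forall>D. symmetric_map D \<longrightarrow> (\<forall>x. D (N x) = N (D x)) \<longrightarrow> (\<forall>x. D (R x) = R (D x)))"
proof -
  define d where "d = max c 1"
  have d: "d > 0" by (simp add: d_def)
  have bd: "norm (N x) \<le> d * norm x" for x
    using b[of x] mult_right_mono[of c d "norm x"] by (simp add: d_def)
  define C where "C x = x - (1/d) *\<^sub>R N x" for x
  have C: "symmetric_map C"
    by (simp add: symmetric_map_def C_def inner_simps symmetric_mapD[OF N(1)])
  have Cb: "norm (C x) \<le> norm x" for x
  proof -
    have "(norm (x - w))\<^sup>2 = (norm x)\<^sup>2 - 2 * inner w x + (norm w)\<^sup>2" for w
      unfolding power2_norm_eq_inner by (simp add: inner_simps inner_commute)
    from this[of "(1/d) *\<^sub>R N x"]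
    have "(norm (C x))\<^sup>2 = (norm x)\<^sup>2 - 2 * (inner (N x) x / d) + (norm (N x))\<^sup>2 / d\<^sup>2"
      by (simp add: C_def power_divide)
    moreover have "(norm (N x))\<^sup>2 / d\<^sup>2 \<le> (d * inner (N x) x) / d\<^sup>2"
      using nonneg_symmetric_map_norm[OF N bd, of x] by (intro divide_right_mono) auto
    moreover have "(d * inner (N x) x) / d\<^sup>2 = inner (N x) x / d" using d by (simp add: power2_eq_square)
    moreover have "0 \<le> inner (N x) x / d" using N(2)[of x] d by simp
    ultimately have "(norm (C x))\<^sup>2 \<le> (norm x)\<^sup>2" by linarith
    then show ?thesis by (rule power2_le_imp_le) simp
  qed
  define Y where "Y x = lim (\<lambda>n. sqrt_iter C n x)" for x
  have lim: "(\<lambda>n. sqrt_iter C n x) \<longlonglongrightarrow> Y x" for x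
    unfolding Y_def using sqrt_iter_convergent[OF C Cb] by (simp add: convergent_LIMSEQ_iff)
  have Ys: "symmetric_map Y"
    unfolding symmetric_map_def
  proof (intro allI)
    fix x y
    have "(\<lambda>n. inner (sqrt_iter C n x) y) \<longlonglongrightarrow> inner (Y x) y" by (intro tendsto_intros lim)
    moreover have "(\<lambda>n. inner x (sqrt_iter C n y)) \<longlonglongrightarrow> inner x (Y y)" by (intro tendsto_intros lim)
    ultimately show "inner (Y x) y = inner x (Y y)"
      using LIMSEQ_unique by (simp add: symmetric_mapD[OF sqrt_iter_symmetric[OF C]])
  qed
  have itb: "norm (sqrt_iter C n x) \<le> norm x" for n x
    using sqrt_iter_norm[OF Cb, of n x] mult_right_mono[of "sqrt_iter_bound n" 1 "norm x"]
      sqrt_iter_bound_range[of n] by simp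
  have Yb: "norm (Y x) \<le> norm x" for x
    by (rule tendsto_upperbound[OF tendsto_norm[OF lim]]) (use itb in auto)
  have lim2: "(\<lambda>n. sqrt_iter C n (sqrt_iter C n x)) \<longlonglongrightarrow> Y (Y x)" for x
  proof -
    have "(\<lambda>n. sqrt_iter C n (sqrt_iter C n x - Y x)) \<longlonglongrightarrow> 0"
    proof (rule Lim_null_comparison)
      show "\<forall>\<^sub>F n in sequentially. norm (sqrt_iter C n (sqrt_iter C n x - Y x)) \<le> norm (sqrt_iter C n x - Y x)"
        using itb by auto
      show "(\<lambda>n. norm (sqrt_iter C n x - Y x)) \<longlonglongrightarrow> 0"
        using lim LIM_zero tendsto_norm_zero by blast
    qed
    from tendsto_add[OF this lim[of "Y x"]] show ?thesis
      by (simp add: linear_diff[OF symmetric_map_linear[OF sqrt_iter_symmetric[OF C]]])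
  qed
  have Yeq: "2 *\<^sub>R Y x = C x + Y (Y x)" for x
  proof -
    have "(\<lambda>n. 2 *\<^sub>R sqrt_iter C (Suc n) x) \<longlonglongrightarrow> 2 *\<^sub>R Y x"
      by (intro tendsto_intros LIMSEQ_Suc[OF lim])
    moreover have "(\<lambda>n. C x + sqrt_iter C n (sqrt_iter C n x)) \<longlonglongrightarrow> C x + Y (Y x)"
      by (intro tendsto_intros lim2)
    ultimately show ?thesis using LIMSEQ_unique by simp
  qed
  note Ylin = symmetric_map_linear[OF Ys]
  define R where "R x = sqrt d *\<^sub>R (x - Y x)" for x
  have "nonneg_sqrt_map N R"
    unfolding nonneg_sqrt_map_def
  proof (intro conjI allI)
    show "symmetric_map R"
      by (simp add: symmetric_map_def R_def inner_simps symmetric_mapD[OF Ys])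
    fix x
    have "inner (Y x) x \<le> norm x * norm x"
      using norm_cauchy_schwarz[of "Y x" x] mult_right_mono[OF Yb[of x] norm_ge_zero[of x]] by linarith
    then show "0 \<le> inner (R x) x"
      using d by (simp add: R_def inner_simps power2_norm_eq_inner[symmetric] power2_eq_square)
    have "R (R x) = d *\<^sub>R (x - 2 *\<^sub>R Y x + Y (Y x))"
      using d by (simp add: R_def linear_diff[OF Ylin] linear_scale[OF Ylin] algebra_simps scaleR_2)
    also have "\<dots> = N x" using d by (simp add: Yeq C_def)
    finally show "R (R x) = N x" .
  qed
  moreover have "D (R x) = R (D x)" if D: "symmetric_map D" "\<And>x. D (N x) = N (D x)" for D x
  proof -
    note Dlin = symmetric_map_linear[OF D(1)]
    have "D (C x) = C (D x)" for x
      by (simp add: C_def linear_diff[OF Dlin] linear_scale[OF Dlin] D(2))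
    then have "D (sqrt_iter C n x) = sqrt_iter C n (D x)" for n x by (rule sqrt_iter_commute[OF Dlin])
    then have "D (Y x) = Y (D x)"
      using symmetric_map_closed[OF D(1) lim] lim by simp
    then show ?thesis by (simp add: R_def linear_diff[OF Dlin] linear_scale[OF Dlin])
  qed
  ultimately show ?thesis by blast
qed

text \<open>
  Let \<open>R\<close> be the square root constructed above and \<open>P\<close> another one. Then \<open>P\<close> commutes with
  \<open>N = P\<^sup>2\<close>, hence with \<open>R\<close>, so \<open>(P + R) y = 0\<close> for \<open>y = (P - R) x\<close>. Both summands are
  non-negative, so \<open>P y = R y = 0\<close>, and therefore \<open>\<parallel>y\<parallel>\<^sup>2 = (x, (P - R) y) = 0\<close>.
\<close>

lemma nonneg_sqrt_map_unique:
  fixes N :: "'a::{real_inner,complete_space} \<Rightarrow> 'a"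
  assumes N: "symmetric_map N" "\<And>x. 0 \<le> inner (N x) x" and b: "\<And>x. norm (N x) \<le> c * norm x"
  shows "\<exists>!R. nonneg_sqrt_map N R"
proof -
  obtain R where R: "nonneg_sqrt_map N R"
    and comm: "\<And>D x. symmetric_map D \<Longrightarrow> (\<And>x. D (N x) = N (D x)) \<Longrightarrow> D (R x) = R (D x)"
    using nonneg_sqrt_map_exists_commuting[OF assms] by blast
  have "P = R" if P: "nonneg_sqrt_map N P" for P
  proof
    fix x
    have Ps: "symmetric_map P" "\<And>x. 0 \<le> inner (P x) x" "\<And>x. P (P x) = N x"
      using P by (auto simp: nonneg_sqrt_map_def)
    have Rs: "symmetric_map R" "\<And>x. 0 \<le> inner (R x) x" "\<And>x. R (R x) = N x"
      using R by (auto simp: nonneg_sqrt_map_def)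
    note linP = symmetric_map_linear[OF Ps(1)] and linR = symmetric_map_linear[OF Rs(1)]
    have PR: "P (R x) = R (P x)" for x
      by (rule comm[OF Ps(1)]) (simp add: Ps(3)[symmetric])
    define y where "y = P x - R x"
    have "P y + R y = 0"
      by (simp add: y_def linear_diff[OF linP] linear_diff[OF linR] Ps Rs PR)
    then have "inner (P y) y + inner (R y) y = 0"
      by (metis inner_add_left inner_zero_left)
    then have "inner (P y) y = 0" "inner (R y) y = 0" using Ps(2)[of y] Rs(2)[of y] by auto
    then have "P y = 0" "R y = 0"
      using nonneg_symmetric_map_kernel[OF Ps(1,2)] nonneg_symmetric_map_kernel[OF Rs(1,2)] by auto
    moreover have "inner y y = inner x (P y) - inner x (R y)"
      by (subst (1) y_def) (simp add: inner_simps symmetric_mapD[OF Ps(1)] symmetric_mapD[OF Rs(1)])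
    ultimately show "P x = R x" by (simp add: y_def)
  qed
  with R show ?thesis by blast
qed

section \<open>Operators in complex Hilbert spaces through the real inner product\<close>

lemma cinner_scaleC_right: "cinner x (c *\<^sub>C y) = cnj c * cinner x y"
  by (metis cinner_commute cinner_scaleC_left complex_cnj_mult)

lemma scaleC_minus_one: "(- 1) *\<^sub>C x = - x"
  using scaleC_of_real[of "-1" x] by simp

lemma scaleC_scaleR: "c *\<^sub>C (r *\<^sub>R x) = r *\<^sub>R (c *\<^sub>C x)"
  by (simp add: scaleC_of_real[symmetric] scaleC_scaleC mult.commute)

lemma linear_scaleC: "linear ((*\<^sub>C) c)"
  by (rule linearI) (simp_all add: scaleC_add_right scaleC_scaleR)

lemma inner_imaginary: "inner (\<i> *\<^sub>C x) y = - inner x (\<i> *\<^sub>C y)"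
  by (simp flip: Re_cinner add: cinner_scaleC_left cinner_scaleC_right)

lemma Im_cinner: "Im (cinner x y) = - inner (\<i> *\<^sub>C x) y"
  by (simp flip: Re_cinner add: cinner_scaleC_left)

lemma scaleC_eq: "c *\<^sub>C x = Re c *\<^sub>R x + Im c *\<^sub>R (\<i> *\<^sub>C x)"
proof -
  have "c *\<^sub>C x = (complex_of_real (Re c) + complex_of_real (Im c) * \<i>) *\<^sub>C x"
    by (metis complex_eq mult.commute)
  then show ?thesis
    by (simp only: scaleC_add_left scaleC_of_real flip: scaleC_scaleC)
qed

lemma norm_imaginary: "norm (\<i> *\<^sub>C x) = norm x"
proof -
  have "inner (\<i> *\<^sub>C x) (\<i> *\<^sub>C x) = inner x x"
    by (simp flip: Re_cinner add: cinner_scaleC_left cinner_scaleC_right)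
  then show ?thesis by (simp add: norm_eq_sqrt_inner)
qed

lemma bounded_linear_scaleC: "bounded_linear ((*\<^sub>C) c)"
proof (intro bounded_linear_intro)
  show "norm (c *\<^sub>C x) \<le> norm x * (\<bar>Re c\<bar> + \<bar>Im c\<bar>)" for x
    using norm_triangle_ineq[of "Re c *\<^sub>R x" "Im c *\<^sub>R (\<i> *\<^sub>C x)"]
    by (subst scaleC_eq) (simp add: norm_imaginary algebra_simps)
qed (simp_all add: scaleC_add_right scaleC_scaleR)

lemma linear_operator_scaleC: "linear_operator A \<Longrightarrow> (x, y) \<in> A \<Longrightarrow> (c *\<^sub>C x, c *\<^sub>C y) \<in> A"
  by (auto simp: linear_operator_def)

lemma linear_operator_scaleR: "linear_operator A \<Longrightarrow> (x, y) \<in> A \<Longrightarrow> (r *\<^sub>R x, r *\<^sub>R y) \<in> A"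
  by (metis linear_operator_scaleC scaleC_of_real)

lemma linear_operator_add:
  "linear_operator A \<Longrightarrow> (x, y) \<in> A \<Longrightarrow> (x', y') \<in> A \<Longrightarrow> (x + x', y + y') \<in> A"
  by (fastforce simp: linear_operator_def)

lemma linear_operator_subspace:
  assumes "linear_operator A"
  shows "subspace A"
  unfolding subspace_def
proof (intro conjI ballI allI)
  show "0 \<in> A" using assms by (simp add: linear_operator_def zero_prod_def)
  show "p + q \<in> A" if "p \<in> A" "q \<in> A" for p q
    using linear_operator_add[OF assms, of "fst p" "snd p" "fst q" "snd q"] that
    by (simp add: plus_prod_def)
  show "r *\<^sub>R p \<in> A" if "p \<in> A" for r p
    using linear_operator_scaleR[OF assms, of "fst p" "snd p" r] that by (simp add: scaleR_prod_def)
qed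

lemma subspace_diff_pair:
  "subspace A \<Longrightarrow> (x, y) \<in> A \<Longrightarrow> (x', y') \<in> A \<Longrightarrow> (x - x', y - y') \<in> A"
  using subspace_diff[of A "(x, y)" "(x', y')"] by simp

text \<open>
  The imaginary part of \<open>cinner x y\<close> is a real inner product with \<open>\<i> x\<close>, so a graph that is
  invariant under \<open>\<i>\<close> has the same adjoint with respect to the complex and the real inner product.
\<close>

lemma adjoint_operator_iff:
  assumes "\<And>x y. (x, y) \<in> A \<Longrightarrow> (\<i> *\<^sub>C x, \<i> *\<^sub>C y) \<in> A"
  shows "(g, h) \<in> adjoint_operator A \<longleftrightarrow> (\<forall>(x, y)\<in>A. inner y g = inner x h)"
proof
  assume "(g, h) \<in> adjoint_operator A"
  then have "\<forall>(x, y)\<in>A. cinner y g = cinner x h" by (simp add: adjoint_operator_def)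
  then show "\<forall>(x, y)\<in>A. inner y g = inner x h" by (auto simp flip: Re_cinner)
next
  assume *: "\<forall>(x, y)\<in>A. inner y g = inner x h"
  have "cinner y g = cinner x h" if "(x, y) \<in> A" for x y
    using * that assms[OF that] by (auto intro!: complex_eqI simp: Im_cinner Re_cinner)
  then show "(g, h) \<in> adjoint_operator A" by (auto simp: adjoint_operator_def)
qed

lemma selfadjoint_operator_subspace: "selfadjoint_operator A \<Longrightarrow> subspace A"
  unfolding selfadjoint_operator_def using linear_operator_subspace by blast

lemma selfadjoint_operator_iff_inner:
  assumes "selfadjoint_operator A"
  shows "(g, h) \<in> A \<longleftrightarrow> (\<forall>(x, y)\<in>A. inner y g = inner x h)"
proof -
  have "linear_operator A" "A = adjoint_operator A" using assms by (auto simp: selfadjoint_operator_def)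
  then show ?thesis using adjoint_operator_iff linear_operator_scaleC by metis
qed

lemma selfadjoint_operator_inner:
  "selfadjoint_operator A \<Longrightarrow> (x, y) \<in> A \<Longrightarrow> (g, h) \<in> A \<Longrightarrow> inner y g = inner x h"
  using selfadjoint_operator_iff_inner by fast

lemma selfadjoint_operator_closed:
  assumes "selfadjoint_operator A"
  shows "closed A"
proof -
  have "A = (\<Inter>(x, y)\<in>A. {p. inner y (fst p) = inner x (snd p)})"
    using selfadjoint_operator_iff_inner[OF assms] by (fastforce simp: set_eq_iff)
  moreover have "closed (\<Inter>(x, y)\<in>A. {p. inner y (fst p) = inner x (snd p)})"
    by (auto intro!: closed_INT closed_Collect_eq continuous_intros)
  ultimately show ?thesis by simp
qed

lemma form_bound_coercive:
  fixes x y :: "'a::real_inner"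
  assumes "c * (norm x)\<^sup>2 \<le> inner y x"
  shows "(c - l) * norm x \<le> norm (y - l *\<^sub>R x)"
proof (cases "x = 0")
  case False
  have "(c - l) * norm x * norm x \<le> inner (y - l *\<^sub>R x) x"
    using assms by (simp add: inner_simps power2_norm_eq_inner power2_eq_square algebra_simps flip: power2_norm_eq_inner)
  also have "\<dots> \<le> norm (y - l *\<^sub>R x) * norm x" by (rule norm_cauchy_schwarz)
  finally show ?thesis using False by simp
qed simp

text \<open>
  Below a form bound \<open>c\<close> the operator \<open>A - l\<close> is bounded below in norm by \<open>c - l\<close>, and a vector
  orthogonal to its range is an eigenvector of \<open>A\<close> for the eigenvalue \<open>l < c\<close>, hence zero.
\<close>

lemma selfadjoint_shift_onto:
  fixes A :: "('a::complex_hilbert_space, 'a) graph"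
  assumes A: "selfadjoint_operator A" and c: "\<And>x y. (x, y) \<in> A \<Longrightarrow> c * (norm x)\<^sup>2 \<le> inner y x"
    and l: "l < c"
  shows "\<exists>x y. (x, y) \<in> A \<and> y - l *\<^sub>R x = h"
proof -
  have sub: "subspace A" using selfadjoint_operator_subspace[OF A] .
  define S where "S p = (fst p, snd p + l *\<^sub>R fst p)" for p :: "'a \<times> 'a"
  have lin: "linear S" by (rule linearI) (auto simp: S_def algebra_simps)
  have "Range (S -` A) = UNIV"
  proof (rule coercive_relation_onto)
    show "subspace (S -` A)" using lin sub by (rule linear_subspace_vimage)
    show "closed (S -` A)"
      by (intro closed_vimage selfadjoint_operator_closed A) (simp add: S_def continuous_intros)
    show "c - l > 0" using l by simp
    show "(c - l) * norm x \<le> norm y" if "(x, y) \<in> S -` A" for x y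
      using form_bound_coercive[OF c, of x "y + l *\<^sub>R x" l] that by (simp add: S_def)
    show "z = 0" if *: "\<And>x y. (x, y) \<in> S -` A \<Longrightarrow> inner y z = 0" for z
    proof -
      have "inner y z = inner x (l *\<^sub>R z)" if "(x, y) \<in> A" for x y
        using *[of x "y - l *\<^sub>R x"] that by (simp add: S_def inner_simps)
      then have "(z, l *\<^sub>R z) \<in> A" using selfadjoint_operator_iff_inner[OF A] by blast
      from form_bound_coercive[OF c[OF this], of l] l show ?thesis by (simp add: mult_le_0_iff)
    qed
  qed
  then have "h \<in> Range (S -` A)" by simp
  then obtain x where "(x, h + l *\<^sub>R x) \<in> A" by (auto simp: S_def)
  then show ?thesis by (intro exI[of _ x] exI[of _ "h + l *\<^sub>R x"]) simp
qed

text \<open>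
  For \<open>(g, h)\<close> in the adjoint, choose \<open>x\<close> in the domain with \<open>(A - l) x = h - l g\<close>; then \<open>g - x\<close>
  is orthogonal to the range of \<open>A - l\<close>, which is everything.
\<close>

lemma selfadjoint_operatorI:
  fixes A :: "('a::complex_hilbert_space, 'a) graph"
  assumes lin: "linear_operator A" and dense: "densely_defined A"
    and sym: "\<And>x y u v. (x, y) \<in> A \<Longrightarrow> (u, v) \<in> A \<Longrightarrow> inner y u = inner x v"
    and onto: "\<And>h. \<exists>x y. (x, y) \<in> A \<and> y - l *\<^sub>R x = h"
  shows "selfadjoint_operator A"
proof -
  note adj = adjoint_operator_iff[of A, OF linear_operator_scaleC[OF lin]]
  have "(g, h) \<in> A" if "(g, h) \<in> adjoint_operator A" for g h
  proof -
    obtain x y where xy: "(x, y) \<in> A" "y - l *\<^sub>R x = h - l *\<^sub>R g" using onto by blast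
    have "inner (v - l *\<^sub>R u) (g - x) = 0" if uv: "(u, v) \<in> A" for u v
    proof -
      have "inner v g = inner u h" using adj that uv \<open>(g, h) \<in> adjoint_operator A\<close> by blast
      moreover have "inner v x = inner u y" using sym[OF uv xy(1)] .
      moreover have "h - y = l *\<^sub>R (g - x)" using xy(2) by (simp add: algebra_simps)
      then have "inner u h - inner u y = l * inner u (g - x)" by (metis inner_diff_right inner_scaleR_right)
      ultimately show ?thesis by (simp add: inner_simps algebra_simps)
    qed
    moreover obtain u v where "(u, v) \<in> A" "v - l *\<^sub>R u = g - x" using onto by blast
    ultimately have "inner (g - x) (g - x) = 0" by metis
    then show ?thesis using xy by simp
  qed
  moreover have "(g, h) \<in> adjoint_operator A" if "(g, h) \<in> A" for g h
    using adj sym that by blast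
  ultimately show ?thesis using lin dense by (auto simp: selfadjoint_operator_def)
qed

section \<open>The bottom of the spectrum\<close>

lemma resolvent_set_iff:
  "complex_of_real l \<in> resolvent_set A \<longleftrightarrow>
    (\<forall>x y u v. (x, y) \<in> A \<and> (u, v) \<in> A \<and> y - l *\<^sub>R x = v - l *\<^sub>R u \<longrightarrow> x = u) \<and>
    (\<forall>h. \<exists>x y. (x, y) \<in> A \<and> y - l *\<^sub>R x = h) \<and>
    (\<exists>c. \<forall>(x, y)\<in>A. norm x \<le> c * norm (y - l *\<^sub>R x))"
proof -
  have 1: "single_valued ((shift_operator A (complex_of_real l))\<inverse>) \<longleftrightarrow>
      (\<forall>x y u v. (x, y) \<in> A \<and> (u, v) \<in> A \<and> y - l *\<^sub>R x = v - l *\<^sub>R u \<longrightarrow> x = u)"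
    unfolding single_valued_def shift_operator_def scaleC_of_real by blast
  have "Domain ((shift_operator A (complex_of_real l))\<inverse>) =
      {h. \<exists>x y. (x, y) \<in> A \<and> y - l *\<^sub>R x = h}"
    unfolding shift_operator_def scaleC_of_real by blast
  then have 2: "Domain ((shift_operator A (complex_of_real l))\<inverse>) = UNIV \<longleftrightarrow>
      (\<forall>h. \<exists>x y. (x, y) \<in> A \<and> y - l *\<^sub>R x = h)"
    by (simp add: set_eq_iff)
  have 3: "bounded_operator ((shift_operator A (complex_of_real l))\<inverse>) \<longleftrightarrow>
      (\<exists>c. \<forall>(x, y)\<in>A. norm x \<le> c * norm (y - l *\<^sub>R x))"
    unfolding bounded_operator_def shift_operator_def scaleC_of_real by fast
  show ?thesis unfolding resolvent_set_def mem_Collect_eq 1 2 3 by blast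
qed

lemma below_form_bound_in_resolvent_set:
  fixes A :: "('a::complex_hilbert_space, 'a) graph"
  assumes A: "selfadjoint_operator A" and c: "\<And>x y. (x, y) \<in> A \<Longrightarrow> c * (norm x)\<^sup>2 \<le> inner y x"
    and l: "l < c"
  shows "complex_of_real l \<in> resolvent_set A"
  unfolding resolvent_set_iff
proof (intro conjI allI impI)
  have sub: "subspace A" using selfadjoint_operator_subspace[OF A] .
  note coer = form_bound_coercive[OF c, of _ _ l]
  show "x = u" if "(x, y) \<in> A \<and> (u, v) \<in> A \<and> y - l *\<^sub>R x = v - l *\<^sub>R u" for x y u v
  proof -
    have "(x - u, y - v) \<in> A" using sub that by (blast intro: subspace_diff_pair)
    from coer[OF this] have "(c - l) * norm (x - u) \<le> norm ((y - l *\<^sub>R x) - (v - l *\<^sub>R u))"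
      by (simp add: algebra_simps)
    then show ?thesis using l that by (simp add: mult_le_0_iff)
  qed
  show "\<exists>c. \<forall>(x, y)\<in>A. norm x \<le> c * norm (y - l *\<^sub>R x)"
    using coer l by (intro exI[of _ "1 / (c - l)"]) (auto simp: field_simps)
  show "\<exists>x y. (x, y) \<in> A \<and> y - l *\<^sub>R x = h" for h
    using selfadjoint_shift_onto[OF A c l] .
qed

text \<open>
  If \<open>m\<close> is both a form bound and in the resolvent set, then the resolvent \<open>R\<close> at \<open>m\<close> is a bounded
  non-negative map, and \<open>\<parallel>R h\<parallel>\<^sup>2 \<le> d (R h, h)\<close> says that \<open>A - m \<ge> 1 / d\<close>.
\<close>

lemma form_bound_improves:
  fixes A :: "('a::complex_hilbert_space, 'a) graph"
  assumes A: "selfadjoint_operator A" and m: "\<And>x y. (x, y) \<in> A \<Longrightarrow> m * (norm x)\<^sup>2 \<le> inner y x"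
    and res: "complex_of_real m \<in> resolvent_set A"
  shows "\<exists>e>0. \<forall>(x, y)\<in>A. (m + e) * (norm x)\<^sup>2 \<le> inner y x"
proof -
  have inj: "\<And>x y u v. (x, y) \<in> A \<Longrightarrow> (u, v) \<in> A \<Longrightarrow> y - m *\<^sub>R x = v - m *\<^sub>R u \<Longrightarrow> x = u"
    and onto: "\<forall>h. \<exists>x y. (x, y) \<in> A \<and> y - m *\<^sub>R x = h"
    and bdd: "\<exists>c. \<forall>(x, y)\<in>A. norm x \<le> c * norm (y - m *\<^sub>R x)"
    using res unfolding resolvent_set_iff by blast+
  obtain R V where RV: "\<And>h. (R h, V h) \<in> A" "\<And>h. V h - m *\<^sub>R R h = h"
    using onto by metis
  obtain c where c: "\<And>x y. (x, y) \<in> A \<Longrightarrow> norm x \<le> c * norm (y - m *\<^sub>R x)" using bdd by blast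
  define d where "d = max c 1"
  have d: "d > 0" by (simp add: d_def)
  have Rs: "symmetric_map R"
    unfolding symmetric_map_def
  proof (intro allI)
    fix x y
    have "inner (R x) (V y) = inner (V x) (R y)"
      using selfadjoint_operator_inner[OF A RV(1) RV(1), of x y] by (simp add: inner_commute)
    then have "inner (R x) (V y - m *\<^sub>R R y) = inner (V x - m *\<^sub>R R x) (R y)" by (simp add: inner_simps)
    then show "inner (R x) y = inner x (R y)" by (simp add: RV(2))
  qed
  have Rn: "0 \<le> inner (R h) h" for h
  proof -
    have "inner (R h) h = inner (R h) (V h - m *\<^sub>R R h)" by (simp add: RV(2))
    also have "\<dots> = inner (V h) (R h) - m * (norm (R h))\<^sup>2"
      by (simp add: inner_simps inner_commute power2_norm_eq_inner)
    finally show ?thesis using m[OF RV(1)[of h]] by simp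
  qed
  have Rb: "norm (R h) \<le> d * norm h" for h
  proof -
    have "norm (R h) \<le> c * norm h" using c[OF RV(1)[of h]] by (simp add: RV(2))
    also have "\<dots> \<le> d * norm h" by (intro mult_right_mono) (auto simp: d_def)
    finally show ?thesis .
  qed
  have "(m + 1 / d) * (norm x)\<^sup>2 \<le> inner y x" if xy: "(x, y) \<in> A" for x y
  proof -
    have "R (y - m *\<^sub>R x) = x" using inj[OF RV(1) xy] RV(2) by simp
    then have "(norm x)\<^sup>2 \<le> d * inner x (y - m *\<^sub>R x)"
      using nonneg_symmetric_map_norm[OF Rs Rn Rb, of "y - m *\<^sub>R x"] by simp
    also have "\<dots> = d * (inner y x - m * (norm x)\<^sup>2)"
      by (simp add: inner_simps inner_commute power2_norm_eq_inner)
    finally show ?thesis using d by (simp add: field_simps)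
  qed
  then show ?thesis using d by (intro exI[of _ "1 / d"]) auto
qed

text \<open>
  The minimum of the spectrum is the largest form bound \<open>m\<close>: everything below a form bound is in
  the resolvent set, and \<open>m\<close> itself is not, since otherwise it could be improved. The non-zero
  vector \<open>x0\<close> is what bounds the set of form bounds from above.
\<close>

lemma le_min_spectrum_iff:
  fixes A :: "('a::complex_hilbert_space, 'a) graph"
  assumes A: "selfadjoint_operator A" and below: "bounded_from_below A"
    and nz: "(x0, y0) \<in> A" "x0 \<noteq> 0"
  shows "c \<le> min_spectrum A \<longleftrightarrow> (\<forall>(x, y)\<in>A. c * (norm x)\<^sup>2 \<le> inner y x)"
proof -
  define F where "F = {c. \<forall>(x, y)\<in>A. c * (norm x)\<^sup>2 \<le> inner y x}"
  have ne: "F \<noteq> {}" using below by (auto simp: bounded_from_below_def F_def Re_cinner)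
  have bdd: "bdd_above F"
    using nz by (intro bdd_aboveI[of _ "inner y0 x0 / (norm x0)\<^sup>2"]) (auto simp: F_def field_simps)
  define m where "m = Sup F"
  have mF: "m \<in> F"
    unfolding F_def
  proof (clarify)
    fix x y assume xy: "(x, y) \<in> A"
    show "m * (norm x)\<^sup>2 \<le> inner y x"
    proof (cases "x = 0")
      case False
      have "m \<le> inner y x / (norm x)\<^sup>2"
        unfolding m_def using False xy by (intro cSup_least ne) (auto simp: F_def field_simps)
      then show ?thesis using False by (simp add: field_simps)
    qed simp
  qed
  have Fle: "r \<in> F \<longleftrightarrow> r \<le> m" for r
  proof
    show "r \<le> m" if "r \<in> F" unfolding m_def using cSup_upper[OF that bdd] .
    assume r: "r \<le> m"
    have "r * (norm x)\<^sup>2 \<le> inner y x" if "(x, y) \<in> A" for x y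
      using mF that mult_right_mono[OF r, of "(norm x)\<^sup>2"] by (fastforce simp: F_def)
    then show "r \<in> F" by (auto simp: F_def)
  qed
  have mb: "\<And>x y. (x, y) \<in> A \<Longrightarrow> m * (norm x)\<^sup>2 \<le> inner y x" using mF by (auto simp: F_def)
  have "min_spectrum A = m"
    unfolding min_spectrum_def
  proof (rule Least_equality)
    show "complex_of_real m \<in> spectrum A"
    proof (rule ccontr)
      assume "complex_of_real m \<notin> spectrum A"
      then obtain e where "e > 0" "m + e \<in> F"
        using form_bound_improves[OF A mb] by (auto simp: spectrum_def F_def)
      then show False using Fle by auto
    qed
    show "m \<le> r" if "complex_of_real r \<in> spectrum A" for r
      using below_form_bound_in_resolvent_set[OF A mb, of r] that by (force simp: spectrum_def)
  qed
  then show ?thesis using Fle[of c] by (simp add: F_def)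
qed

section \<open>Square roots of operators\<close>

lemma selfadjoint_operator_graph:
  fixes R :: "'a::complex_hilbert_space \<Rightarrow> 'a"
  assumes R: "symmetric_map R" and hom: "\<And>c x. R (c *\<^sub>C x) = c *\<^sub>C R x"
  shows "selfadjoint_operator {(x, y). y = R x}"
proof -
  note lin = symmetric_map_linear[OF R]
  have "linear_operator {(x, y). y = R x}"
    by (auto simp: linear_operator_def single_valued_def hom linear_add[OF lin] linear_0[OF lin])
  moreover have "densely_defined {(x, y). y = R x}"
    by (simp add: densely_defined_def Domain_unfold)
  moreover have "(g, h) \<in> adjoint_operator {(x, y). y = R x} \<longleftrightarrow> h = R g" for g h
  proof -
    have "(g, h) \<in> adjoint_operator {(x, y). y = R x} \<longleftrightarrow> (\<forall>x. inner (R x) g = inner x h)"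
      by (subst adjoint_operator_iff) (auto simp: hom)
    also have "\<dots> \<longleftrightarrow> (\<forall>x. inner (R g) x = inner h x)"
      by (metis inner_commute symmetric_mapD[OF R])
    also have "\<dots> \<longleftrightarrow> h = R g" using inner_ext by blast
    finally show ?thesis .
  qed
  ultimately show ?thesis by (auto simp: selfadjoint_operator_def)
qed

text \<open>
  The square root as a map of real Hilbert spaces is complex linear by uniqueness: conjugating it
  with \<open>\<i>\<close> gives another square root. Conversely, a self-adjoint relation \<open>P\<close> with \<open>P O P\<close>
  everywhere defined is itself the graph of a symmetric map, so no unbounded competitor exists.
\<close>

lemma sqrt_operator_graph:
  fixes N :: "'a::complex_hilbert_space \<Rightarrow> 'a"
  assumes N: "symmetric_map N" "\<And>x. 0 \<le> inner (N x) x" and b: "\<And>x. norm (N x) \<le> c * norm x"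
    and hom: "\<And>c x. N (c *\<^sub>C x) = c *\<^sub>C N x"
  shows "\<exists>R. nonneg_sqrt_map N R \<and> sqrt_operator {(x, y). y = N x} = {(x, y). y = R x}"
proof -
  obtain R where R: "nonneg_sqrt_map N R" and unique: "\<And>P. nonneg_sqrt_map N P \<Longrightarrow> P = R"
    using nonneg_sqrt_map_unique[OF N b] by blast
  have Rs: "symmetric_map R" "\<And>x. 0 \<le> inner (R x) x" "\<And>x. R (R x) = N x"
    using R by (auto simp: nonneg_sqrt_map_def)
  note lin = symmetric_map_linear[OF Rs(1)]
  have ii: "\<i> *\<^sub>C \<i> *\<^sub>C x = - x" for x :: 'a by (simp add: scaleC_scaleC scaleC_minus_one)
  have neg: "\<i> *\<^sub>C (- x) = - (\<i> *\<^sub>C x)" for x :: 'a using linear_neg[OF linear_scaleC] .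
  have "nonneg_sqrt_map N (\<lambda>x. - (\<i> *\<^sub>C R (\<i> *\<^sub>C x)))"
    unfolding nonneg_sqrt_map_def
  proof (intro conjI allI)
    show "symmetric_map (\<lambda>x. - (\<i> *\<^sub>C R (\<i> *\<^sub>C x)))"
      unfolding symmetric_map_def by (simp add: inner_imaginary symmetric_mapD[OF Rs(1)])
    fix x
    show "0 \<le> inner (- (\<i> *\<^sub>C R (\<i> *\<^sub>C x))) x" using Rs(2) by (simp add: inner_imaginary)
    show "- (\<i> *\<^sub>C R (\<i> *\<^sub>C (- (\<i> *\<^sub>C R (\<i> *\<^sub>C x))))) = N x"
      by (simp add: neg ii linear_neg[OF lin] Rs(3) hom)
  qed
  from unique[OF this] have "R x = - (\<i> *\<^sub>C R (\<i> *\<^sub>C x))" for x by metis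
  then have "R (\<i> *\<^sub>C x) = \<i> *\<^sub>C R x" for x using ii neg by (metis minus_minus)
  then have Rhom: "R (c *\<^sub>C x) = c *\<^sub>C R x" for c x
    by (subst (1 2) scaleC_eq) (simp add: linear_add[OF lin] linear_scale[OF lin])
  have "sqrt_operator {(x, y). y = N x} = {(x, y). y = R x}"
    unfolding sqrt_operator_def
  proof (rule the_equality, intro conjI)
    show "selfadjoint_operator {(x, y). y = R x}" using selfadjoint_operator_graph[OF Rs(1) Rhom] .
    show "nonnegative_operator {(x, y). y = R x}"
      using Rs(2) by (auto simp: nonnegative_operator_def Re_cinner)
    show "{(x, y). y = R x} O {(x, y). y = R x} = {(x, y). y = N x}"
      using Rs(3) by (auto simp: relcomp_unfold)
  next
    fix P assume "selfadjoint_operator P \<and> nonnegative_operator P \<and> P O P = {(x, y). y = N x}"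
    then have P: "selfadjoint_operator P" "nonnegative_operator P" "P O P = {(x, y). y = N x}" by auto
    have "\<exists>y. (x, y) \<in> P" for x
    proof -
      have "(x, N x) \<in> P O P" using P(3) by simp
      then show ?thesis by blast
    qed
    then obtain p where p: "\<And>x. (x, p x) \<in> P" by metis
    have "single_valued P" using P(1) by (simp add: selfadjoint_operator_def linear_operator_def)
    then have Pp: "P = {(x, y). y = p x}" using p by (auto dest: single_valuedD)
    have "nonneg_sqrt_map N p"
      unfolding nonneg_sqrt_map_def symmetric_map_def
    proof (intro conjI allI)
      show "inner (p x) y = inner x (p y)" for x y using selfadjoint_operator_inner[OF P(1) p p] .
      show "0 \<le> inner (p x) x" for x using P(2) p[of x] by (auto simp: nonnegative_operator_def Re_cinner)
      have "(x, p (p x)) \<in> P O P" for x using p by blast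
      then show "p (p x) = N x" for x using P(3) by simp
    qed
    then show "P = {(x, y). y = R x}" using unique Pp by simp
  qed
  with R show ?thesis by blast
qed

section \<open>Bounded densely defined operators\<close>

lemma closure_induct:
  assumes "p \<in> closure X" "\<And>q. q \<in> X \<Longrightarrow> P q" "closed {q. P q}"
  shows "P p"
  using assms closure_minimal[of X "{q. P q}"] by blast

lemma subspace_closure:
  fixes V :: "'a::real_normed_vector set"
  assumes "subspace V"
  shows "subspace (closure V)"
  unfolding subspace_def
proof (intro conjI ballI allI)
  show "0 \<in> closure V" using subspace_0[OF assms] closure_subset by blast
  show "x + y \<in> closure V" if "x \<in> closure V" "y \<in> closure V" for x y
  proof -
    obtain u v where "\<forall>n. u n \<in> V" "u \<longlonglongrightarrow> x" "\<forall>n. v n \<in> V" "v \<longlonglongrightarrow> y"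
      using \<open>x \<in> closure V\<close> \<open>y \<in> closure V\<close> unfolding closure_sequential by blast
    then show ?thesis
      unfolding closure_sequential
      by (intro exI[of _ "\<lambda>n. u n + v n"]) (auto intro: subspace_add assms tendsto_add)
  qed
  show "c *\<^sub>R x \<in> closure V" if "x \<in> closure V" for c x
  proof -
    obtain u where "\<forall>n. u n \<in> V" "u \<longlonglongrightarrow> x"
      using \<open>x \<in> closure V\<close> unfolding closure_sequential by blast
    then show ?thesis
      unfolding closure_sequential
      by (intro exI[of _ "\<lambda>n. c *\<^sub>R u n"]) (auto intro: subspace_scale assms tendsto_intros)
  qed
qed

text \<open>
  The bound turns a Cauchy sequence in the domain into a Cauchy sequence of values, so that the
  operator extends by continuity to the closure of its domain.
\<close>

lemma closure_bounded_graph: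
  fixes M :: "('a::real_normed_vector \<times> 'b::{real_normed_vector,complete_space}) set"
  assumes M: "subspace M" and dense: "closure (Domain M) = UNIV"
    and bound: "\<And>x y. (x, y) \<in> M \<Longrightarrow> norm y \<le> c * norm x"
  shows "\<exists>N. closure M = {(x, y). y = N x}"
proof -
  have bcl: "norm (snd p) \<le> c * norm (fst p)" if "p \<in> closure M" for p
    using that by (rule closure_induct)
      (use bound in \<open>auto intro!: closed_Collect_le continuous_intros\<close>)
  have scl: "subspace (closure M)" using M by (rule subspace_closure)
  have "\<exists>y. (x, y) \<in> closure M" for x
  proof -
    have "x \<in> closure (Domain M)" using dense by simp
    then obtain u where u: "\<And>n. u n \<in> Domain M" "u \<longlonglongrightarrow> x" unfolding closure_sequential by blast
    then obtain v where v: "\<And>n. (u n, v n) \<in> M" unfolding Domain_iff by metis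
    define d where "d = max c 1"
    have d: "d > 0" by (simp add: d_def)
    have le: "norm (v m - v n) \<le> d * norm (u m - u n)" for m n
    proof -
      have "norm (v m - v n) \<le> c * norm (u m - u n)"
        using bound subspace_diff[OF M v[of m] v[of n]] by simp
      also have "\<dots> \<le> d * norm (u m - u n)" by (intro mult_right_mono) (auto simp: d_def)
      finally show ?thesis .
    qed
    have "Cauchy v"
    proof (rule metric_CauchyI)
      fix e :: real assume "e > 0"
      then have "e / d > 0" using d by simp
      then obtain N where N: "\<And>m n. m \<ge> N \<Longrightarrow> n \<ge> N \<Longrightarrow> dist (u m) (u n) < e / d"
        using LIMSEQ_imp_Cauchy[OF u(2)] unfolding Cauchy_def by meson
      have "dist (v m) (v n) < e" if "m \<ge> N" "n \<ge> N" for m n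
        using le[of m n] N[OF that] d by (simp add: dist_norm field_simps)
      then show "\<exists>M. \<forall>m\<ge>M. \<forall>n\<ge>M. dist (v m) (v n) < e" by blast
    qed
    then obtain y where "v \<longlonglongrightarrow> y" using Cauchy_convergent convergent_def by blast
    then have "(\<lambda>n. (u n, v n)) \<longlonglongrightarrow> (x, y)" using u(2) by (intro tendsto_Pair)
    then have "(x, y) \<in> closure M"
      unfolding closure_sequential using v by (intro exI[of _ "\<lambda>n. (u n, v n)"]) auto
    then show ?thesis by blast
  qed
  then obtain N where N: "\<And>x. (x, N x) \<in> closure M" by metis
  have "y = N x" if "(x, y) \<in> closure M" for x y
    using bcl[of "(x, y) - (x, N x)"] subspace_diff[OF scl that N[of x]] by simp
  with N show ?thesis by auto
qed

lemma operator_norm_upper: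
  assumes "\<And>x y. (x, y) \<in> A \<Longrightarrow> norm y \<le> c * norm x" and "(x, y) \<in> A"
  shows "norm y / norm x \<le> operator_norm A"
proof -
  have "bdd_above ((\<lambda>(x, y). norm y / norm x) ` A)"
  proof (rule bdd_aboveI2, clarify)
    fix x y assume "(x, y) \<in> A"
    then have "norm y \<le> max c 0 * norm x"
      using assms(1)[of x y] mult_right_mono[of c "max c 0" "norm x"] by fastforce
    then show "norm y / norm x \<le> max c 0" by (cases "x = 0") (simp_all add: field_simps)
  qed
  then have "(case (x, y) of (x, y) \<Rightarrow> norm y / norm x) \<le> operator_norm A"
    unfolding operator_norm_def using assms(2) by (intro cSUP_upper)
  then show ?thesis by simp
qed

lemma operator_norm_bound:
  assumes "\<And>x y. (x, y) \<in> A \<Longrightarrow> norm y \<le> c * norm x" and "(x, y) \<in> A"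
  shows "norm y \<le> operator_norm A * norm x"
  using operator_norm_upper[OF assms] assms(1)[OF assms(2)] by (cases "x = 0") (simp_all add: field_simps)

section \<open>Quasi boundary triples with a semibounded reference operator\<close>

lemma scale_operator_iff:
  "(x, y) \<in> scale_operator (complex_of_real r) B \<longleftrightarrow> (\<exists>z. (x, z) \<in> B \<and> y = r *\<^sub>R z)"
  by (auto simp: scale_operator_def scaleC_of_real)

lemma linear_operator_scale:
  assumes "linear_operator B"
  shows "linear_operator (scale_operator (complex_of_real r) B)"
  unfolding linear_operator_def
proof (intro conjI ballI allI, safe)
  let ?B = "scale_operator (complex_of_real r) B"
  show "single_valued ?B"
    using assms by (auto simp: linear_operator_def single_valued_def scale_operator_iff)
  show "(0, 0) \<in> ?B" using assms by (auto simp: linear_operator_def scale_operator_iff)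
  show "(x + x', y + y') \<in> ?B" if "(x, y) \<in> ?B" "(x', y') \<in> ?B" for x y x' y'
    using that linear_operator_add[OF assms] unfolding scale_operator_iff by (metis scaleR_add_right)
  show "(c *\<^sub>C x, c *\<^sub>C y) \<in> ?B" if "(x, y) \<in> ?B" for c x y
    using that linear_operator_scaleC[OF assms] unfolding scale_operator_iff by (metis scaleC_scaleR)
qed

lemma bdry_kernel_restriction_iff:
  "(f, y) \<in> bdry_kernel_restriction T \<Gamma> \<longleftrightarrow> (f, y) \<in> T \<and> \<Gamma> f = 0"
  by (auto simp: bdry_kernel_restriction_def restrict_operator_def)

lemma boundary_extension_iff:
  "(f, y) \<in> boundary_extension T \<Gamma>0 \<Gamma>1 B \<longleftrightarrow> (f, y) \<in> T \<and> (\<Gamma>1 f, \<Gamma>0 f) \<in> B"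
  by (auto simp: boundary_extension_def restrict_operator_def)

lemma weyl_function_iff:
  "(\<phi>, \<psi>) \<in> weyl_function T \<Gamma>0 \<Gamma>1 l \<longleftrightarrow> (\<exists>f. (f, l *\<^sub>C f) \<in> T \<and> \<phi> = \<Gamma>0 f \<and> \<psi> = \<Gamma>1 f)"
  by (auto simp: weyl_function_def gamma_field_def kernel_def shift_operator_def)

text \<open>
  Here \<open>m\<close> is any form bound of \<open>A0\<close>; it is instantiated with the minimum of the spectrum of \<open>A0\<close>.
\<close>

locale semibounded_triple =
  fixes S T :: "('h::complex_hilbert_space, 'h) graph"
    and \<Gamma>0 \<Gamma>1 :: "'h \<Rightarrow> 'g::complex_hilbert_space"
    and m :: real
  assumes S: "symmetric_operator S"
    and triple: "quasi_boundary_triple S T \<Gamma>0 \<Gamma>1"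
    and below: "\<And>f y. (f, y) \<in> T \<Longrightarrow> \<Gamma>0 f = 0 \<Longrightarrow> m * (norm f)\<^sup>2 \<le> inner y f"
    and weyl_bounded_somewhere:
      "\<exists>l\<in>resolvent_set (bdry_kernel_restriction T \<Gamma>0). bounded_operator (weyl_function T \<Gamma>0 \<Gamma>1 l)"
    and weyl_vanishes:
      "((\<lambda>l. operator_norm (closure (weyl_function T \<Gamma>0 \<Gamma>1 (complex_of_real l)))) \<longlongrightarrow> 0) at_bot"
begin

abbreviation M :: "real \<Rightarrow> ('g, 'g) graph" where
  "M l \<equiv> weyl_function T \<Gamma>0 \<Gamma>1 (complex_of_real l)"

abbreviation A0 :: "('h, 'h) graph" where
  "A0 \<equiv> bdry_kernel_restriction T \<Gamma>0"

lemma linT: "linear_operator T"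
  and A0_selfadjoint: "selfadjoint_operator A0"
  using triple by (auto simp: quasi_boundary_triple_def)

lemma T_add_scaleR:
  assumes "(f, y) \<in> T" "(g, z) \<in> T"
  shows "(f + r *\<^sub>R g, y + r *\<^sub>R z) \<in> T"
    and "\<Gamma>0 (f + r *\<^sub>R g) = \<Gamma>0 f + r *\<^sub>R \<Gamma>0 g" and "\<Gamma>1 (f + r *\<^sub>R g) = \<Gamma>1 f + r *\<^sub>R \<Gamma>1 g"
proof -
  have rg: "(r *\<^sub>R g, r *\<^sub>R z) \<in> T" using assms by (simp add: linear_operator_scaleR[OF linT])
  then show "(f + r *\<^sub>R g, y + r *\<^sub>R z) \<in> T" using assms by (simp add: linear_operator_add[OF linT])
  have dom: "f \<in> Domain T" "g \<in> Domain T" "r *\<^sub>R g \<in> Domain T" using assms rg by auto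
  have l0: "linear_map_on (Domain T) \<Gamma>0" and l1: "linear_map_on (Domain T) \<Gamma>1"
    using triple by (auto simp: quasi_boundary_triple_def)
  from l0 dom show "\<Gamma>0 (f + r *\<^sub>R g) = \<Gamma>0 f + r *\<^sub>R \<Gamma>0 g"
    unfolding linear_map_on_def by (metis scaleC_of_real)
  from l1 dom show "\<Gamma>1 (f + r *\<^sub>R g) = \<Gamma>1 f + r *\<^sub>R \<Gamma>1 g"
    unfolding linear_map_on_def by (metis scaleC_of_real)
qed

lemma T_add:
  assumes "(f, y) \<in> T" "(g, z) \<in> T"
  shows "(f + g, y + z) \<in> T" "\<Gamma>0 (f + g) = \<Gamma>0 f + \<Gamma>0 g" "\<Gamma>1 (f + g) = \<Gamma>1 f + \<Gamma>1 g"
  using T_add_scaleR[OF assms, of 1] by simp_all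

lemma T_diff:
  assumes "(f, y) \<in> T" "(g, z) \<in> T"
  shows "(f - g, y - z) \<in> T" "\<Gamma>0 (f - g) = \<Gamma>0 f - \<Gamma>0 g" "\<Gamma>1 (f - g) = \<Gamma>1 f - \<Gamma>1 g"
  using T_add_scaleR[OF assms, of "-1"] by simp_all

lemma T_scaleC:
  assumes "(f, y) \<in> T"
  shows "(c *\<^sub>C f, c *\<^sub>C y) \<in> T" "\<Gamma>0 (c *\<^sub>C f) = c *\<^sub>C \<Gamma>0 f" "\<Gamma>1 (c *\<^sub>C f) = c *\<^sub>C \<Gamma>1 f"
  using assms triple linear_operator_scaleC[OF linT] DomainI[OF assms]
  by (auto simp: quasi_boundary_triple_def linear_map_on_def simp del: Domain_iff)

lemma T_zero: "(0, 0) \<in> T" "\<Gamma>0 0 = 0" "\<Gamma>1 0 = 0"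
proof -
  show z: "(0, 0) \<in> T" using linT by (simp add: linear_operator_def)
  show "\<Gamma>0 0 = 0" "\<Gamma>1 0 = 0" using T_diff[OF z z] by simp_all
qed

lemma green:
  assumes "(f, y) \<in> T" "(g, z) \<in> T"
  shows "inner y g - inner f z = inner (\<Gamma>1 f) (\<Gamma>0 g) - inner (\<Gamma>0 f) (\<Gamma>1 g)"
proof -
  have "cinner y g - cinner f z = cinner (\<Gamma>1 f) (\<Gamma>0 g) - cinner (\<Gamma>0 f) (\<Gamma>1 g)"
    using triple assms by (fastforce simp: quasi_boundary_triple_def)
  then have "Re (cinner y g - cinner f z) = Re (cinner (\<Gamma>1 f) (\<Gamma>0 g) - cinner (\<Gamma>0 f) (\<Gamma>1 g))" by simp
  then show ?thesis by (simp add: Re_cinner)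
qed

lemma range_\<Gamma>0_dense: "closure (\<Gamma>0 ` Domain T) = UNIV"
proof -
  let ?X = "(\<lambda>f. (\<Gamma>0 f, \<Gamma>1 f)) ` Domain T"
  have "closure ?X = UNIV" using triple by (simp add: quasi_boundary_triple_def)
  then have "(x, 0) \<in> closure ?X" for x by simp
  then have "fst (x, 0 :: 'g) \<in> closure (\<Gamma>0 ` Domain T)" for x
    by (rule closure_induct)
      (auto intro!: closed_vimage[of "closure (\<Gamma>0 ` Domain T)" fst, unfolded vimage_def]
        continuous_intros closure_subset[THEN subsetD])
  then show ?thesis by auto
qed

text \<open>
  Since \<open>T \<subseteq> S\<^sup>*\<close>, every element of \<open>S\<close> lies in the adjoint of \<open>A0\<close>, which is \<open>A0\<close>. Green's
  identity then shows that \<open>\<Gamma>1 f\<close> is orthogonal to the dense range of \<open>\<Gamma>0\<close>.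
\<close>

lemma S_subset:
  assumes "(f, y) \<in> S"
  shows "(f, y) \<in> T" "\<Gamma>0 f = 0" "\<Gamma>1 f = 0"
proof -
  have TS: "inner z f = inner g y" if "(g, z) \<in> T" for g z
  proof -
    have "(g, z) \<in> adjoint_operator S" using triple that by (auto simp: quasi_boundary_triple_def)
    then have "cinner y g = cinner f z" using assms by (auto simp: adjoint_operator_def)
    then show ?thesis by (metis Re_cinner inner_commute)
  qed
  then have "\<forall>(x, z)\<in>A0. inner z f = inner x y" by (auto simp: bdry_kernel_restriction_iff)
  then have "(f, y) \<in> A0" by (simp add: selfadjoint_operator_iff_inner[OF A0_selfadjoint])
  then show f: "(f, y) \<in> T" "\<Gamma>0 f = 0" by (auto simp: bdry_kernel_restriction_iff)
  have "inner \<phi> (\<Gamma>1 f) = 0" for \<phi>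
  proof -
    have "\<phi> \<in> closure (\<Gamma>0 ` Domain T)" by (simp add: range_\<Gamma>0_dense)
    then show ?thesis
    proof (rule closure_induct)
      show "closed {\<phi>. inner \<phi> (\<Gamma>1 f) = 0}" by (intro closed_Collect_eq continuous_intros)
      fix \<phi> assume "\<phi> \<in> \<Gamma>0 ` Domain T"
      then obtain g z where g: "(g, z) \<in> T" "\<phi> = \<Gamma>0 g" by auto
      then show "inner \<phi> (\<Gamma>1 f) = 0"
        using green[OF f(1) g(1)] TS[OF g(1)] f(2) by (simp add: inner_commute)
    qed
  qed
  from this[of "\<Gamma>1 f"] show "\<Gamma>1 f = 0" by simp
qed

lemma A0_solve:
  assumes "l < m"
  shows "\<exists>f y. (f, y) \<in> T \<and> \<Gamma>0 f = 0 \<and> y - l *\<^sub>R f = h"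
proof -
  have "\<exists>f y. (f, y) \<in> A0 \<and> y - l *\<^sub>R f = h"
    by (rule selfadjoint_shift_onto[OF A0_selfadjoint _ assms])
      (use below in \<open>auto simp: bdry_kernel_restriction_iff\<close>)
  then show ?thesis by (simp add: bdry_kernel_restriction_iff)
qed

text \<open>
  The decomposition \<open>dom T = dom A0 + ker (T - l)\<close>: every boundary value in \<open>ran \<Gamma>0\<close> is attained
  on \<open>ker (T - l)\<close>.
\<close>

lemma \<Gamma>0_lift:
  assumes "l < m" "(f, y) \<in> T"
  shows "\<exists>u. (u, l *\<^sub>R u) \<in> T \<and> \<Gamma>0 u = \<Gamma>0 f"
proof -
  obtain g z where g: "(g, z) \<in> T" "\<Gamma>0 g = 0" "z - l *\<^sub>R g = y - l *\<^sub>R f"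
    using A0_solve[OF assms(1)] by blast
  have "y - z = l *\<^sub>R (f - g)" using g(3) by (simp add: algebra_simps)
  then show ?thesis using T_diff[OF assms(2) g(1)] g(2) by (intro exI[of _ "f - g"]) simp
qed

lemma M_iff: "(\<phi>, \<psi>) \<in> M l \<longleftrightarrow> (\<exists>u. (u, l *\<^sub>R u) \<in> T \<and> \<phi> = \<Gamma>0 u \<and> \<psi> = \<Gamma>1 u)"
  by (simp add: weyl_function_iff scaleC_of_real)

lemma M_eq: "M l = {(\<Gamma>0 u, \<Gamma>1 u) | u. (u, l *\<^sub>R u) \<in> T}"
  by (auto simp: M_iff)

lemma Domain_M:
  assumes "l < m"
  shows "Domain (M l) = \<Gamma>0 ` Domain T"
  using \<Gamma>0_lift[OF assms] by (fastforce simp: Domain_iff M_iff image_iff)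

lemma M_subspace: "subspace (M l)"
  unfolding subspace_def
proof (intro conjI ballI allI)
  show "0 \<in> M l" unfolding zero_prod_def M_iff by (intro exI[of _ 0]) (simp add: T_zero)
  show "p + q \<in> M l" if pq: "p \<in> M l" "q \<in> M l" for p q
  proof -
    obtain u where u: "(u, l *\<^sub>R u) \<in> T" "p = (\<Gamma>0 u, \<Gamma>1 u)" using pq(1) unfolding M_eq by blast
    obtain v where v: "(v, l *\<^sub>R v) \<in> T" "q = (\<Gamma>0 v, \<Gamma>1 v)" using pq(2) unfolding M_eq by blast
    show ?thesis
      unfolding u v plus_prod_def fst_conv snd_conv M_iff
      using T_add[OF u(1) v(1)] by (intro exI[of _ "u + v"]) (simp add: scaleR_add_right)
  qed
  show "r *\<^sub>R p \<in> M l" if p: "p \<in> M l" for r p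
  proof -
    obtain u where u: "(u, l *\<^sub>R u) \<in> T" "p = (\<Gamma>0 u, \<Gamma>1 u)" using p unfolding M_eq by blast
    show ?thesis
      unfolding u scaleR_prod_def fst_conv snd_conv M_iff
      using T_add_scaleR[OF T_zero(1) u(1), of r] by (intro exI[of _ "r *\<^sub>R u"]) (simp add: T_zero mult.commute)
  qed
qed

section \<open>Boundedness of the Weyl function\<close>

text \<open>
  Green's identity in the form \<open>\<gamma>(l)\<^sup>* (A0 - l) f = \<Gamma>1 f\<close> for \<open>f \<in> dom A0\<close>.
\<close>

lemma adjoint_gamma:
  assumes "(f, y) \<in> T" "\<Gamma>0 f = 0" "(u, l *\<^sub>R u) \<in> T"
  shows "inner (y - l *\<^sub>R f) u = inner (\<Gamma>1 f) (\<Gamma>0 u)"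
  using green[OF assms(1,3)] assms(2) by (simp add: inner_simps)

text \<open>
  By the preceding identity, and because \<open>A0 - l\<close> is onto, \<open>\<gamma>(l)\<close> is weakly bounded on the unit
  ball of \<open>ran \<Gamma>0\<close>, so the uniform boundedness principle applies.
\<close>

lemma gamma_bounded:
  assumes l: "l < m"
  shows "\<exists>c\<ge>0. \<forall>u. (u, l *\<^sub>R u) \<in> T \<longrightarrow> norm u \<le> c * norm (\<Gamma>0 u)"
proof -
  have "\<exists>c. \<forall>u\<in>{u. (u, l *\<^sub>R u) \<in> T \<and> norm (\<Gamma>0 u) \<le> 1}. norm u \<le> c"
  proof (rule weakly_bounded_imp_bounded)
    fix h
    obtain f y where f: "(f, y) \<in> T" "\<Gamma>0 f = 0" "y - l *\<^sub>R f = h" using A0_solve[OF l] by blast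
    have "\<bar>inner u h\<bar> \<le> norm (\<Gamma>1 f)" if u: "(u, l *\<^sub>R u) \<in> T" "norm (\<Gamma>0 u) \<le> 1" for u
    proof -
      have "\<bar>inner u h\<bar> = \<bar>inner (\<Gamma>1 f) (\<Gamma>0 u)\<bar>"
        using adjoint_gamma[OF f(1,2) u(1)] f(3) by (simp add: inner_commute)
      also have "\<dots> \<le> norm (\<Gamma>1 f) * norm (\<Gamma>0 u)" by (rule Cauchy_Schwarz_ineq2)
      also have "\<dots> \<le> norm (\<Gamma>1 f) * 1" using u(2) by (intro mult_left_mono) auto
      finally show ?thesis by simp
    qed
    then show "\<exists>c. \<forall>u\<in>{u. (u, l *\<^sub>R u) \<in> T \<and> norm (\<Gamma>0 u) \<le> 1}. \<bar>inner u h\<bar> \<le> c" by blast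
  qed
  then obtain c where c: "\<And>u. (u, l *\<^sub>R u) \<in> T \<Longrightarrow> norm (\<Gamma>0 u) \<le> 1 \<Longrightarrow> norm u \<le> c" by blast
  have c0: "c \<ge> 0" using c[of 0] T_zero by simp
  have "norm u \<le> c * norm (\<Gamma>0 u)" if u: "(u, l *\<^sub>R u) \<in> T" for u
  proof (cases "\<Gamma>0 u = 0")
    case True
    have "(m - l) * norm u \<le> 0" using form_bound_coercive[OF below[OF u True], of l] by simp
    then show ?thesis using l True by (simp add: mult_le_0_iff)
  next
    case False
    let ?r = "1 / norm (\<Gamma>0 u)"
    have "(?r *\<^sub>R u, l *\<^sub>R (?r *\<^sub>R u)) \<in> T" "\<Gamma>0 (?r *\<^sub>R u) = ?r *\<^sub>R \<Gamma>0 u"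
      using T_add_scaleR[OF T_zero(1) u, of ?r] by (simp_all add: T_zero mult.commute)
    from c[OF this(1)] this(2) False show ?thesis by (simp add: field_simps)
  qed
  with c0 show ?thesis by blast
qed

lemma adjoint_gamma_bounded:
  assumes l: "l < m"
  shows "\<exists>c\<ge>0. \<forall>f y. (f, y) \<in> T \<longrightarrow> \<Gamma>0 f = 0 \<longrightarrow> norm (\<Gamma>1 f) \<le> c * norm (y - l *\<^sub>R f)"
proof -
  obtain c where c0: "c \<ge> 0" and c: "\<And>u. (u, l *\<^sub>R u) \<in> T \<Longrightarrow> norm u \<le> c * norm (\<Gamma>0 u)"
    using gamma_bounded[OF l] by blast
  have "norm (\<Gamma>1 f) \<le> c * norm (y - l *\<^sub>R f)" if f: "(f, y) \<in> T" "\<Gamma>0 f = 0" for f y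
  proof -
    have "inner (\<Gamma>1 f) \<phi> \<le> norm (y - l *\<^sub>R f) * (c * norm \<phi>)" for \<phi>
    proof (rule closure_induct[where P = "\<lambda>\<phi>. inner (\<Gamma>1 f) \<phi> \<le> norm (y - l *\<^sub>R f) * (c * norm \<phi>)"])
      show "\<phi> \<in> closure (\<Gamma>0 ` Domain T)" by (simp add: range_\<Gamma>0_dense)
    next
      show "closed {\<phi>. inner (\<Gamma>1 f) \<phi> \<le> norm (y - l *\<^sub>R f) * (c * norm \<phi>)}"
        by (intro closed_Collect_le continuous_intros)
      fix \<phi> assume "\<phi> \<in> \<Gamma>0 ` Domain T"
      then obtain u where u: "(u, l *\<^sub>R u) \<in> T" "\<phi> = \<Gamma>0 u" using \<Gamma>0_lift[OF l] by fastforce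
      have "inner (\<Gamma>1 f) \<phi> = inner (y - l *\<^sub>R f) u" using adjoint_gamma[OF f u(1)] u(2) by simp
      also have "\<dots> \<le> norm (y - l *\<^sub>R f) * norm u" by (rule norm_cauchy_schwarz)
      also have "\<dots> \<le> norm (y - l *\<^sub>R f) * (c * norm \<phi>)" using c[OF u(1)] u(2) by (simp add: mult_left_mono)
      finally show "inner (\<Gamma>1 f) \<phi> \<le> norm (y - l *\<^sub>R f) * (c * norm \<phi>)" .
    qed
    from this[of "\<Gamma>1 f"] have "norm (\<Gamma>1 f) * norm (\<Gamma>1 f) \<le> (c * norm (y - l *\<^sub>R f)) * norm (\<Gamma>1 f)"
      by (simp add: power2_norm_eq_inner[symmetric] power2_eq_square ac_simps)
    then show ?thesis using c0 by (cases "\<Gamma>1 f = 0") auto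
  qed
  with c0 show ?thesis by blast
qed

text \<open>
  Given \<open>u \<in> ker (T - l)\<close>, let \<open>v = u - w \<in> ker (T - k)\<close> have the same boundary value \<open>\<Gamma>0\<close>, where
  \<open>k\<close> is the possibly non-real point at which the Weyl function is known to be bounded. Then \<open>w\<close>
  is obtained from \<open>u\<close> by the resolvent of \<open>A0\<close> at \<open>k\<close>, and \<open>M(l) - M(k)\<close> maps the boundary value
  to \<open>\<Gamma>1 w = \<gamma>(l)\<^sup>* (l - k) v\<close>, so it is bounded because \<open>\<gamma>(l)\<close>, its adjoint and that resolvent
  are.
\<close>

lemma M_bounded:
  assumes l: "l < m"
  shows "\<exists>c. \<forall>(\<phi>, \<psi>)\<in>M l. norm \<psi> \<le> c * norm \<phi>"
proof -
  obtain k where k: "k \<in> resolvent_set A0" "bounded_operator (weyl_function T \<Gamma>0 \<Gamma>1 k)"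
    using weyl_bounded_somewhere by blast
  obtain c0 where c0: "\<And>v. (v, k *\<^sub>C v) \<in> T \<Longrightarrow> norm (\<Gamma>1 v) \<le> c0 * norm (\<Gamma>0 v)"
    using k(2) unfolding bounded_operator_def by (fastforce simp: weyl_function_iff)
  obtain c1 where c1: "\<And>f y. (f, y) \<in> T \<Longrightarrow> \<Gamma>0 f = 0 \<Longrightarrow> norm f \<le> c1 * norm (y - k *\<^sub>C f)"
    using k(1) unfolding resolvent_set_def bounded_operator_def
    by (fastforce simp: shift_operator_def bdry_kernel_restriction_iff)
  have onto: "\<exists>f y. (f, y) \<in> T \<and> \<Gamma>0 f = 0 \<and> y - k *\<^sub>C f = h" for h
  proof -
    have "h \<in> Domain ((shift_operator A0 k)\<inverse>)" using k(1) by (simp add: resolvent_set_def)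
    then show ?thesis by (auto simp: shift_operator_def bdry_kernel_restriction_iff)
  qed
  obtain c2 where c2: "c2 \<ge> 0" "\<And>u. (u, l *\<^sub>R u) \<in> T \<Longrightarrow> norm u \<le> c2 * norm (\<Gamma>0 u)"
    using gamma_bounded[OF l] by blast
  obtain c3 where c3: "c3 \<ge> 0"
      "\<And>f y. (f, y) \<in> T \<Longrightarrow> \<Gamma>0 f = 0 \<Longrightarrow> norm (\<Gamma>1 f) \<le> c3 * norm (y - l *\<^sub>R f)"
    using adjoint_gamma_bounded[OF l] by blast
  obtain d where d: "d > 0" "\<And>x :: 'h. norm ((complex_of_real l - k) *\<^sub>C x) \<le> norm x * d"
    using bounded_linear.pos_bounded[OF bounded_linear_scaleC[of "complex_of_real l - k"]] by blast
  have sub: "(complex_of_real l - k) *\<^sub>C x = l *\<^sub>R x - k *\<^sub>C x" for x :: 'h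
    using scaleC_add_left[of "complex_of_real l - k" k x] by (simp add: scaleC_of_real)
  have "norm (\<Gamma>1 u) \<le> (c0 + c3 * (d * ((1 + \<bar>c1\<bar> * d) * c2))) * norm (\<Gamma>0 u)"
    if u: "(u, l *\<^sub>R u) \<in> T" for u
  proof -
    obtain w z where w: "(w, z) \<in> T" "\<Gamma>0 w = 0" "z - k *\<^sub>C w = (complex_of_real l - k) *\<^sub>C u"
      using onto by blast
    define v where "v = u - w"
    have kv: "k *\<^sub>C v = k *\<^sub>C u - k *\<^sub>C w" unfolding v_def using linear_diff[OF linear_scaleC] .
    have z: "z = l *\<^sub>R u - k *\<^sub>C u + k *\<^sub>C w" using w(3) unfolding sub by (simp only: diff_eq_eq)
    have v: "(v, k *\<^sub>C v) \<in> T" "\<Gamma>0 v = \<Gamma>0 u" "\<Gamma>1 v = \<Gamma>1 u - \<Gamma>1 w"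
    proof -
      have "k *\<^sub>C v = l *\<^sub>R u - z" unfolding kv z by simp
      then show "(v, k *\<^sub>C v) \<in> T" "\<Gamma>0 v = \<Gamma>0 u" "\<Gamma>1 v = \<Gamma>1 u - \<Gamma>1 w"
        using T_diff[OF u w(1)] w(2) by (simp_all add: v_def)
    qed
    have "norm w \<le> c1 * norm ((complex_of_real l - k) *\<^sub>C u)" using c1[OF w(1,2)] w(3) by simp
    also have "\<dots> \<le> \<bar>c1\<bar> * (norm u * d)"
      using d(2)[of u] by (intro mult_mono) auto
    finally have nv: "norm v \<le> (1 + \<bar>c1\<bar> * d) * norm u"
      using norm_triangle_ineq4[of u w] by (simp add: v_def algebra_simps)
    have "z - l *\<^sub>R w = (complex_of_real l - k) *\<^sub>C v"
      unfolding sub kv z by (simp add: v_def scaleR_diff_right)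
    then have "norm (\<Gamma>1 w) \<le> c3 * norm ((complex_of_real l - k) *\<^sub>C v)" using c3(2)[OF w(1,2)] by simp
    also have "\<dots> \<le> c3 * (norm v * d)" using d(2)[of v] c3(1) by (intro mult_left_mono)
    also have "\<dots> \<le> c3 * (((1 + \<bar>c1\<bar> * d) * (c2 * norm (\<Gamma>0 u))) * d)"
    proof (intro mult_left_mono mult_right_mono)
      have "(1 + \<bar>c1\<bar> * d) * norm u \<le> (1 + \<bar>c1\<bar> * d) * (c2 * norm (\<Gamma>0 u))"
        using c2(2)[OF u] d(1) by (intro mult_left_mono) auto
      with nv show "norm v \<le> (1 + \<bar>c1\<bar> * d) * (c2 * norm (\<Gamma>0 u))" by linarith
    qed (use d c3 in auto)
    finally have "norm (\<Gamma>1 w) \<le> (c3 * (d * ((1 + \<bar>c1\<bar> * d) * c2))) * norm (\<Gamma>0 u)"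
      by (simp add: ac_simps)
    moreover have "norm (\<Gamma>1 u) \<le> norm (\<Gamma>1 v) + norm (\<Gamma>1 w)"
      using norm_triangle_ineq[of "\<Gamma>1 v" "\<Gamma>1 w"] v(3) by simp
    moreover have "norm (\<Gamma>1 v) \<le> c0 * norm (\<Gamma>0 u)" using c0[OF v(1)] v(2) by simp
    ultimately show ?thesis by (simp add: distrib_right)
  qed
  then show ?thesis by (intro exI) (auto simp: M_iff)
qed

lemma closure_M_bounded:
  assumes l: "l < m"
  shows "\<exists>c. \<forall>(\<phi>, \<psi>)\<in>closure (M l). norm \<psi> \<le> c * norm \<phi>"
proof -
  obtain c where c: "\<And>\<phi> \<psi>. (\<phi>, \<psi>) \<in> M l \<Longrightarrow> norm \<psi> \<le> c * norm \<phi>" using M_bounded[OF l] by blast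
  have "norm (snd p) \<le> c * norm (fst p)" if "p \<in> closure (M l)" for p
    using that by (rule closure_induct)
      (use c in \<open>auto intro!: closed_Collect_le continuous_intros\<close>)
  then show ?thesis by (intro exI[of _ c]) force
qed

lemma closure_M_norm:
  assumes "l < m" "(\<phi>, \<psi>) \<in> closure (M l)"
  shows "norm \<psi> \<le> operator_norm (closure (M l)) * norm \<phi>"
  using closure_M_bounded[OF assms(1)] operator_norm_bound[OF _ assms(2)] by blast

lemma operator_norm_closure_M_nonneg:
  assumes "l < m"
  shows "0 \<le> operator_norm (closure (M l))"
proof -
  have "0 \<in> closure (M l)" using subspace_0[OF subspace_closure[OF M_subspace]] .
  then have "norm (0 :: 'g) / norm (0 :: 'g) \<le> operator_norm (closure (M l))"
    using closure_M_bounded[OF assms] operator_norm_upper[of "closure (M l)" _ 0 0]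
    unfolding zero_prod_def by blast
  then show ?thesis by simp
qed

lemma M_norm:
  assumes "l < m" "(u, l *\<^sub>R u) \<in> T"
  shows "norm (\<Gamma>1 u) \<le> operator_norm (closure (M l)) * norm (\<Gamma>0 u)"
  using assms by (intro closure_M_norm closure_subset[THEN subsetD]) (auto simp: M_iff)

lemma M_inner_le:
  assumes "l < m" "(u, l *\<^sub>R u) \<in> T"
  shows "\<bar>inner (\<Gamma>0 u) (\<Gamma>1 u)\<bar> \<le> operator_norm (closure (M l)) * (norm (\<Gamma>0 u))\<^sup>2"
proof -
  have "\<bar>inner (\<Gamma>0 u) (\<Gamma>1 u)\<bar> \<le> norm (\<Gamma>0 u) * norm (\<Gamma>1 u)" by (rule Cauchy_Schwarz_ineq2)
  also have "\<dots> \<le> norm (\<Gamma>0 u) * (operator_norm (closure (M l)) * norm (\<Gamma>0 u))"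
    using M_norm[OF assms] by (intro mult_left_mono) auto
  finally show ?thesis by (simp add: power2_eq_square ac_simps)
qed

section \<open>The form of the reference operator\<close>

text \<open>
  With \<open>y = T f\<close> this extends the quadratic form of \<open>A0 - l\<close> to \<open>dom T\<close>; the boundary term is the
  one that Green's identity requires for a hermitian form.
\<close>

definition ref_form :: "real \<Rightarrow> 'h \<Rightarrow> 'h \<Rightarrow> real" where
  "ref_form l f y = inner (y - l *\<^sub>R f) f + inner (\<Gamma>0 f) (\<Gamma>1 f)"

text \<open>
  Here \<open>f - v\<close> lies in \<open>dom A0\<close>, so that the first term is the value of the form of \<open>A0 - l\<close>.
\<close>

lemma ref_form_split:
  assumes f: "(f, y) \<in> T" and v: "(v, k *\<^sub>R v) \<in> T" "\<Gamma>0 v = \<Gamma>0 f"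
  shows "ref_form l f y = inner ((y - k *\<^sub>R v) - l *\<^sub>R (f - v)) (f - v)
    + 2 * inner (y - l *\<^sub>R f) v + (l - k) * (norm v)\<^sup>2 + inner (\<Gamma>0 v) (\<Gamma>1 v)"
  using green[OF f v(1)] v(2) unfolding ref_form_def power2_norm_eq_inner
  by (simp add: inner_simps inner_commute algebra_simps)

text \<open>
  In the splitting above the first term is non-negative, and the second and third are at least
  \<open>- \<parallel>w\<parallel>\<^sup>2 / (l - k)\<close> with \<open>w = (T - l) f\<close>. The last term is at least \<open>- \<parallel>M(k)\<parallel> \<parallel>\<Gamma>0 f\<parallel>\<^sup>2\<close>. Both
  bounds tend to \<open>0\<close> as \<open>k \<rightarrow> -\<infinity>\<close>.
\<close>

lemma ref_form_nonneg:
  assumes l: "l < m" and f: "(f, y) \<in> T"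
  shows "0 \<le> ref_form l f y"
proof (rule ccontr)
  assume "\<not> ?thesis"
  then have neg: "ref_form l f y < 0" by simp
  define w where "w = y - l *\<^sub>R f"
  \<comment> \<open>If both error terms are controlled by e, the form is at least half of its own negative value.\<close>
  define e where "e = - ref_form l f y / (2 * (1 + (norm (\<Gamma>0 f))\<^sup>2))"
  have pos: "1 + (norm (\<Gamma>0 f))\<^sup>2 > 0" by (simp add: add_pos_nonneg)
  have e: "e > 0" using neg pos by (simp add: e_def field_simps)
  have "\<forall>\<^sub>F k in at_bot. operator_norm (closure (M k)) < e"
    using order_tendstoD(2)[OF weyl_vanishes e] .
  moreover have "\<forall>\<^sub>F k in at_bot. k < l - (norm w)\<^sup>2 / e" by simp
  ultimately have "\<forall>\<^sub>F k in at_bot. operator_norm (closure (M k)) < e \<and> k < l - (norm w)\<^sup>2 / e"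
    by (rule eventually_conj)
  then obtain k where k: "operator_norm (closure (M k)) < e" "k < l - (norm w)\<^sup>2 / e"
    using eventually_happens' by (metis (no_types, lifting) trivial_limit_at_bot_linorder)
  have "(norm w)\<^sup>2 / e \<ge> 0" using e by simp
  then have s: "l - k > 0" "k < m" using k l by linarith+
  obtain v where v: "(v, k *\<^sub>R v) \<in> T" "\<Gamma>0 v = \<Gamma>0 f" using \<Gamma>0_lift[OF s(2) f] by blast
  have "l * (norm (f - v))\<^sup>2 \<le> m * (norm (f - v))\<^sup>2" using l by (intro mult_right_mono) auto
  then have "0 \<le> inner ((y - k *\<^sub>R v) - l *\<^sub>R (f - v)) (f - v)"
    using below[OF T_diff(1)[OF f v(1)]] T_diff(2)[OF f v(1)] v(2)
    by (simp add: inner_diff_left[of "y - k *\<^sub>R v" "l *\<^sub>R (f - v)"] power2_norm_eq_inner)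
  then have 1: "2 * inner w v + (l - k) * (norm v)\<^sup>2 + inner (\<Gamma>0 v) (\<Gamma>1 v) \<le> ref_form l f y"
    unfolding ref_form_split[OF f v, of l] w_def by linarith
  \<comment> \<open>Completing the square makes the bound independent of the size of v.\<close>
  have "(norm (w + (l - k) *\<^sub>R v))\<^sup>2 = (norm w)\<^sup>2 + (l - k) * (2 * inner w v + (l - k) * (norm v)\<^sup>2)"
    unfolding power2_norm_eq_inner by (simp add: inner_simps inner_commute algebra_simps)
  then have "0 \<le> (norm w)\<^sup>2 + (l - k) * (2 * inner w v + (l - k) * (norm v)\<^sup>2)"
    by (metis zero_le_power2)
  then have "- ((norm w)\<^sup>2 / (l - k)) \<le> 2 * inner w v + (l - k) * (norm v)\<^sup>2"
    using s(1) by (simp add: field_simps)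
  moreover have "(norm w)\<^sup>2 / (l - k) \<le> e"
  proof -
    have "(norm w)\<^sup>2 / e \<le> l - k" using k(2) by linarith
    then show ?thesis using e s(1) by (simp add: field_simps)
  qed
  moreover have "- (e * (norm (\<Gamma>0 f))\<^sup>2) \<le> inner (\<Gamma>0 v) (\<Gamma>1 v)"
    using M_inner_le[OF s(2) v(1)] mult_right_mono[of "operator_norm (closure (M k))" e "(norm (\<Gamma>0 f))\<^sup>2"] k(1) v(2)
    by simp
  ultimately have "- (e * (1 + (norm (\<Gamma>0 f))\<^sup>2)) \<le> ref_form l f y" using 1 by (simp add: distrib_left)
  moreover have "e * (1 + (norm (\<Gamma>0 f))\<^sup>2) = - ref_form l f y / 2"
    using less_imp_neq[OF pos] unfolding e_def by (metis nonzero_mult_div_cancel_right divide_divide_eq_left times_divide_eq_left)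
  ultimately show False using neg by linarith
qed

text \<open>
  By Green's identity the mixed term of the form at \<open>f\<close> and \<open>u \<in> ker (T - l)\<close> is \<open>(\<Gamma>1 f, \<Gamma>0 u)\<close>.
\<close>

lemma ref_form_gamma:
  assumes f: "(f, y) \<in> T" and u: "(u, l *\<^sub>R u) \<in> T"
  shows "ref_form l (f + s *\<^sub>R u) (y + s *\<^sub>R (l *\<^sub>R u)) =
    ref_form l f y + 2 * s * inner (\<Gamma>1 f) (\<Gamma>0 u) + s\<^sup>2 * inner (\<Gamma>0 u) (\<Gamma>1 u)"
proof -
  have "inner y u - l * inner f u = inner (\<Gamma>1 f) (\<Gamma>0 u) - inner (\<Gamma>0 f) (\<Gamma>1 u)" using green[OF f u] by simp
  then have "s * inner y u = s * (l * inner f u + inner (\<Gamma>1 f) (\<Gamma>0 u) - inner (\<Gamma>0 f) (\<Gamma>1 u))" by simp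
  then show ?thesis
    unfolding ref_form_def T_add_scaleR[OF f u, of s]
    by (simp add: inner_simps inner_commute algebra_simps power2_eq_square)
qed

text \<open>
  Cauchy-Schwarz for the form at \<open>f\<close> and \<open>\<gamma>(l)\<phi>\<close> bounds \<open>(\<Gamma>1 f, \<phi>)\<close> for \<open>\<phi> \<in> ran \<Gamma>0\<close>; by density
  one may take \<open>\<phi> = \<Gamma>1 f\<close>.
\<close>

lemma norm_\<Gamma>1_le_ref_form:
  assumes l: "l < m" and f: "(f, y) \<in> T"
  shows "(norm (\<Gamma>1 f))\<^sup>2 \<le> operator_norm (closure (M l)) * ref_form l f y"
proof -
  let ?n = "operator_norm (closure (M l))" and ?t = "ref_form l f y"
  have t: "0 \<le> ?t" using ref_form_nonneg[OF l f] .
  have *: "(inner (\<Gamma>1 f) \<phi>)\<^sup>2 \<le> ?t * (?n * (norm \<phi>)\<^sup>2)" for \<phi>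
  proof (rule closure_induct[where P = "\<lambda>\<phi>. (inner (\<Gamma>1 f) \<phi>)\<^sup>2 \<le> ?t * (?n * (norm \<phi>)\<^sup>2)"])
    show "\<phi> \<in> closure (\<Gamma>0 ` Domain T)" by (simp add: range_\<Gamma>0_dense)
  next
    show "closed {\<phi>. (inner (\<Gamma>1 f) \<phi>)\<^sup>2 \<le> ?t * (?n * (norm \<phi>)\<^sup>2)}"
      by (intro closed_Collect_le continuous_intros)
    fix \<phi> assume "\<phi> \<in> \<Gamma>0 ` Domain T"
    then obtain u where u: "(u, l *\<^sub>R u) \<in> T" "\<phi> = \<Gamma>0 u" using \<Gamma>0_lift[OF l] by fastforce
    have "(inner (\<Gamma>1 f) \<phi>)\<^sup>2 \<le> ?t * inner (\<Gamma>0 u) (\<Gamma>1 u)"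
    proof (rule discriminant_le)
      fix s
      show "0 \<le> ?t + 2 * s * inner (\<Gamma>1 f) \<phi> + s\<^sup>2 * inner (\<Gamma>0 u) (\<Gamma>1 u)"
        using ref_form_nonneg[OF l T_add_scaleR(1)[OF f u(1), of s]] unfolding ref_form_gamma[OF f u(1)] u(2) .
    qed
    also have "\<dots> \<le> ?t * (?n * (norm \<phi>)\<^sup>2)"
      using M_inner_le[OF l u(1)] u(2) t by (intro mult_left_mono) auto
    finally show "(inner (\<Gamma>1 f) \<phi>)\<^sup>2 \<le> ?t * (?n * (norm \<phi>)\<^sup>2)" .
  qed
  show ?thesis
  proof (cases "\<Gamma>1 f = 0")
    case True
    then show ?thesis using t operator_norm_closure_M_nonneg[OF l] by simp
  next
    case False
    have "(norm (\<Gamma>1 f))\<^sup>2 * (norm (\<Gamma>1 f))\<^sup>2 \<le> (?n * ?t) * (norm (\<Gamma>1 f))\<^sup>2"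
      using *[of "\<Gamma>1 f"] by (simp add: power2_norm_eq_inner[symmetric] power2_eq_square ac_simps)
    then show ?thesis using False by (subst (asm) mult_le_cancel_right) auto
  qed
qed


section \<open>The closure of the Weyl function\<close>

lemma M_symmetric:
  assumes "(\<phi>, \<psi>) \<in> M l" "(\<phi>', \<psi>') \<in> M l"
  shows "inner \<psi> \<phi>' = inner \<phi> \<psi>'"
proof -
  obtain u where u: "(u, l *\<^sub>R u) \<in> T" "\<phi> = \<Gamma>0 u" "\<psi> = \<Gamma>1 u" using assms(1) unfolding M_iff by blast
  obtain v where v: "(v, l *\<^sub>R v) \<in> T" "\<phi>' = \<Gamma>0 v" "\<psi>' = \<Gamma>1 v" using assms(2) unfolding M_iff by blast
  show ?thesis using green[OF u(1) v(1)] u v by simp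
qed

lemma closure_M_symmetric:
  assumes "p \<in> closure (M l)" "q \<in> closure (M l)"
  shows "inner (snd p) (fst q) = inner (fst p) (snd q)"
proof -
  have *: "inner (snd p) (fst q) = inner (fst p) (snd q)" if "p \<in> M l" "q \<in> closure (M l)" for p q
    using that(2)
  proof (rule closure_induct)
    show "closed {q. inner (snd p) (fst q) = inner (fst p) (snd q)}"
      by (intro closed_Collect_eq continuous_intros)
    show "inner (snd p) (fst q) = inner (fst p) (snd q)" if "q \<in> M l" for q
      using M_symmetric[of "fst p" "snd p" l "fst q" "snd q"] that \<open>p \<in> M l\<close> by simp
  qed
  show ?thesis
    using assms(1)
  proof (rule closure_induct)
    show "closed {p. inner (snd p) (fst q) = inner (fst p) (snd q)}"
      by (intro closed_Collect_eq continuous_intros)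
  qed (use * assms(2) in auto)
qed

lemma closure_M_scaleC:
  assumes "p \<in> closure (M l)"
  shows "(c *\<^sub>C fst p, c *\<^sub>C snd p) \<in> closure (M l)"
  using assms
proof (rule closure_induct)
  have "continuous_on UNIV (\<lambda>p :: 'g \<times> 'g. (c *\<^sub>C fst p, c *\<^sub>C snd p))"
    by (intro continuous_on_Pair bounded_linear.continuous_on[OF bounded_linear_scaleC] continuous_intros)
  from closed_vimage[OF closed_closure this, of "M l"]
  show "closed {p. (c *\<^sub>C fst p, c *\<^sub>C snd p) \<in> closure (M l)}" by (simp add: vimage_def)
  show "(c *\<^sub>C fst p, c *\<^sub>C snd p) \<in> closure (M l)" if p: "p \<in> M l" for p
  proof -
    obtain u where u: "(u, l *\<^sub>R u) \<in> T" "p = (\<Gamma>0 u, \<Gamma>1 u)" using p unfolding M_eq by blast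
    have "(c *\<^sub>C fst p, c *\<^sub>C snd p) \<in> M l"
      unfolding M_iff using T_scaleC[OF u(1), of c] u(2) by (intro exI[of _ "c *\<^sub>C u"]) (simp add: scaleC_scaleR)
    then show ?thesis using closure_subset by blast
  qed
qed

text \<open>
  On \<open>ker (T - l)\<close> the form \<open>ref_form\<close> reduces to \<open>(M(l)\<phi>, \<phi>)\<close>.
\<close>

lemma closure_M_nonneg:
  assumes l: "l < m" and p: "p \<in> closure (M l)"
  shows "0 \<le> inner (snd p) (fst p)"
  using p
proof (rule closure_induct)
  show "closed {p :: 'g \<times> 'g. 0 \<le> inner (snd p) (fst p)}"
    by (intro closed_Collect_le continuous_intros)
  show "0 \<le> inner (snd p) (fst p)" if p: "p \<in> M l" for p
  proof -
    obtain u where u: "(u, l *\<^sub>R u) \<in> T" "p = (\<Gamma>0 u, \<Gamma>1 u)" using p unfolding M_eq by blast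
    have "0 \<le> ref_form l u (l *\<^sub>R u)" using ref_form_nonneg[OF l u(1)] .
    then show ?thesis using u(2) by (simp add: ref_form_def inner_commute)
  qed
qed

lemma closure_M_graph:
  assumes l: "l < m"
  shows "\<exists>N R. closure (M l) = {(x, y). y = N x} \<and> nonneg_sqrt_map N R
    \<and> sqrt_operator (closure (M l)) = {(x, y). y = R x}"
proof -
  obtain c where c: "\<And>\<phi> \<psi>. (\<phi>, \<psi>) \<in> M l \<Longrightarrow> norm \<psi> \<le> c * norm \<phi>" using M_bounded[OF l] by blast
  have "closure (Domain (M l)) = UNIV" by (simp add: Domain_M[OF l] range_\<Gamma>0_dense)
  then obtain N where N: "closure (M l) = {(x, y). y = N x}"
    using closure_bounded_graph[OF M_subspace _ c] by blast
  then have Nx: "(x, N x) \<in> closure (M l)" for x by simp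
  have "symmetric_map N"
    unfolding symmetric_map_def using closure_M_symmetric[OF Nx Nx] by simp
  moreover have "0 \<le> inner (N x) x" for x using closure_M_nonneg[OF l Nx] by simp
  moreover have "norm (N x) \<le> operator_norm (closure (M l)) * norm x" for x
    using closure_M_norm[OF l Nx] .
  moreover have "N (c *\<^sub>C x) = c *\<^sub>C N x" for c x
  proof -
    have "(c *\<^sub>C x, c *\<^sub>C N x) \<in> closure (M l)" using closure_M_scaleC[OF Nx, of c x] by simp
    then show ?thesis using N by simp
  qed
  ultimately obtain R where "nonneg_sqrt_map N R" "sqrt_operator {(x, y). y = N x} = {(x, y). y = R x}"
    using sqrt_operator_graph[of N] by blast
  then show ?thesis using N by auto
qed

section \<open>Extensions given by a boundary operator\<close>

abbreviation ext :: "('g, 'g) graph \<Rightarrow> ('h, 'h) graph" where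
  "ext B \<equiv> boundary_extension T \<Gamma>0 \<Gamma>1 B"

lemma ext_linear:
  assumes B: "linear_operator B"
  shows "linear_operator (ext B)"
  unfolding linear_operator_def
proof (intro conjI ballI allI, safe)
  show "single_valued (ext B)"
    using linT by (auto simp: linear_operator_def single_valued_def boundary_extension_iff)
  show "(0, 0) \<in> ext B" using B by (simp add: boundary_extension_iff T_zero linear_operator_def)
  show "(f + g, y + z) \<in> ext B" if "(f, y) \<in> ext B" "(g, z) \<in> ext B" for f y g z
    using that T_add[of f y g z] linear_operator_add[OF B] by (auto simp: boundary_extension_iff)
  show "(c *\<^sub>C f, c *\<^sub>C y) \<in> ext B" if "(f, y) \<in> ext B" for c f y
    using that T_scaleC[of f y c] linear_operator_scaleC[OF B] by (auto simp: boundary_extension_iff)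
qed

lemma S_subset_ext:
  assumes "(0, 0) \<in> B"
  shows "S \<subseteq> ext B"
  using S_subset assms by (auto simp: boundary_extension_iff)

lemma ext_symmetric:
  assumes B: "\<And>x y u v. (x, y) \<in> B \<Longrightarrow> (u, v) \<in> B \<Longrightarrow> inner y u = inner x v"
    and "(f, y) \<in> ext B" "(g, z) \<in> ext B"
  shows "inner y g = inner f z"
  using green[of f y g z] B[of "\<Gamma>1 f" "\<Gamma>0 f" "\<Gamma>1 g" "\<Gamma>0 g"] assms(2,3)
  by (simp add: boundary_extension_iff)

text \<open>
  On the domain of the extension \<open>((T - l) f, f)\<close> is the form \<open>ref_form\<close> minus \<open>(B \<Gamma>1 f, \<Gamma>1 f)\<close>,
  and the latter is at most \<open>b \<parallel>M(l)\<parallel>\<close> times the former.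
\<close>

lemma ext_form_bound:
  assumes l: "l < m" and b: "b \<ge> 0" "b * operator_norm (closure (M l)) \<le> 1"
    and B: "\<And>x y. (x, y) \<in> B \<Longrightarrow> inner y x \<le> b * (norm x)\<^sup>2"
    and f: "(f, y) \<in> ext B"
  shows "l * (norm f)\<^sup>2 \<le> inner y f"
proof -
  let ?n = "operator_norm (closure (M l))" and ?t = "ref_form l f y"
  have T: "(f, y) \<in> T" and bc: "(\<Gamma>1 f, \<Gamma>0 f) \<in> B" using f by (auto simp: boundary_extension_iff)
  have "inner (\<Gamma>0 f) (\<Gamma>1 f) \<le> b * (norm (\<Gamma>1 f))\<^sup>2" using B[OF bc] .
  also have "\<dots> \<le> b * (?n * ?t)" using norm_\<Gamma>1_le_ref_form[OF l T] b(1) by (rule mult_left_mono)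
  also have "\<dots> \<le> 1 * ?t"
    using mult_right_mono[OF b(2) ref_form_nonneg[OF l T]] by (simp add: mult.assoc)
  also have "1 * ?t = inner y f - l * (norm f)\<^sup>2 + inner (\<Gamma>0 f) (\<Gamma>1 f)"
    by (simp add: ref_form_def inner_diff_left power2_norm_eq_inner)
  finally show ?thesis by linarith
qed

text \<open>
  Krein's ansatz: \<open>f = f0 + v\<close> with \<open>f0 = inverse (A0 - l) h\<close> and \<open>v = \<gamma>(l)\<phi>\<close> solves the equation
  if \<open>\<phi> = B (M(l)\<phi> + \<Gamma>1 f0)\<close>. With \<open>R\<close> the square root of the closure \<open>N\<close> of \<open>M(l)\<close> and \<open>Q = B R\<close>,
  applying \<open>R\<close> turns this into an equation for \<open>u = R \<phi>\<close> with the symmetric map \<open>R Q = R B R\<close>,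
  which is at most \<open>b \<parallel>M(l)\<parallel> < 1\<close>. The hypotheses on ranges ensure that the solution \<open>\<phi>\<close> lies in
  \<open>ran \<Gamma>0\<close>.
\<close>

lemma ext_shift_onto:
  assumes l: "l < m" and b: "b \<ge> 0" "b * operator_norm (closure (M l)) < 1"
    and linB: "linear_operator B"
    and symB: "\<And>x y u v. (x, y) \<in> B \<Longrightarrow> (u, v) \<in> B \<Longrightarrow> inner y u = inner x v"
    and B: "\<And>x y. (x, y) \<in> B \<Longrightarrow> inner y x \<le> b * (norm x)\<^sup>2"
    and ran_sqrt: "Range (sqrt_operator (closure (M l))) \<subseteq> Domain B"
    and ran_M: "B `` Range (closure (M l)) \<subseteq> \<Gamma>0 ` Domain T"
    and ran_\<Gamma>1: "\<Gamma>1 ` Domain T \<subseteq> Domain B" "B `` (\<Gamma>1 ` Domain T) \<subseteq> \<Gamma>0 ` Domain T"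
  shows "\<exists>f y. (f, y) \<in> ext B \<and> y - l *\<^sub>R f = h"
proof -
  obtain N R where N: "closure (M l) = {(x, y). y = N x}" and NR: "nonneg_sqrt_map N R"
    and sq: "sqrt_operator (closure (M l)) = {(x, y). y = R x}"
    using closure_M_graph[OF l] by blast
  have R: "symmetric_map R" "\<And>x. R (R x) = N x" using NR by (auto simp: nonneg_sqrt_map_def)
  have "\<exists>y. (R x, y) \<in> B" for x using ran_sqrt unfolding sq by blast
  then obtain Q where Q: "\<And>x. (R x, Q x) \<in> B" by metis
  obtain f0 y0 where f0: "(f0, y0) \<in> T" "\<Gamma>0 f0 = 0" "y0 - l *\<^sub>R f0 = h" using A0_solve[OF l] by blast
  have dom0: "\<Gamma>1 f0 \<in> \<Gamma>1 ` Domain T" using f0(1) by blast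
  then obtain \<beta> where \<beta>: "(\<Gamma>1 f0, \<beta>) \<in> B" using ran_\<Gamma>1(1) by blast
  have "\<exists>u. u - R (Q u) = R \<beta>"
  proof (rule symmetric_map_coercive_onto)
    show "symmetric_map (\<lambda>u. R (Q u))"
      unfolding symmetric_map_def using symB[OF Q Q] symmetric_mapD[OF R(1)] by metis
    show "b * operator_norm (closure (M l)) < 1" by (rule b(2))
    fix u
    have "inner (R (Q u)) u = inner (Q u) (R u)" by (rule symmetric_mapD[OF R(1)])
    also have "\<dots> \<le> b * (norm (R u))\<^sup>2" by (rule B[OF Q])
    also have "(norm (R u))\<^sup>2 = inner (N u) u"
      by (simp add: power2_norm_eq_inner symmetric_mapD[OF R(1), of "R u" u, symmetric] R(2))
    also have "b * inner (N u) u \<le> b * (operator_norm (closure (M l)) * (norm u)\<^sup>2)"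
    proof (rule mult_left_mono[OF _ b(1)])
      have "inner (N u) u \<le> norm (N u) * norm u" by (rule norm_cauchy_schwarz)
      also have "\<dots> \<le> operator_norm (closure (M l)) * norm u * norm u"
        using closure_M_norm[OF l, of u "N u"] N by (intro mult_right_mono) auto
      finally show "inner (N u) u \<le> operator_norm (closure (M l)) * (norm u)\<^sup>2"
        by (simp add: power2_eq_square mult.assoc)
    qed
    finally show "inner (R (Q u)) u \<le> b * operator_norm (closure (M l)) * (norm u)\<^sup>2"
      by (simp add: mult.assoc)
  qed
  then obtain u where u: "u - R (Q u) = R \<beta>" by blast
  define \<phi> where "\<phi> = Q u + \<beta>"
  have "R \<phi> = R (Q u) + R \<beta>" unfolding \<phi>_def by (rule linear_add[OF symmetric_map_linear[OF R(1)]])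
  then have "R \<phi> = u" using u by (simp add: diff_eq_eq add.commute)
  then have N\<phi>: "N \<phi> = R u" using R(2)[of \<phi>] by simp
  have "Q u \<in> \<Gamma>0 ` Domain T"
  proof -
    have "N \<phi> \<in> Range (closure (M l))" using N by blast
    then show ?thesis using ran_M Q[of u] unfolding N\<phi> by blast
  qed
  then obtain g1 z1 where g1: "(g1, z1) \<in> T" "Q u = \<Gamma>0 g1" by auto
  have "\<beta> \<in> \<Gamma>0 ` Domain T" using ran_\<Gamma>1(2) \<beta> dom0 by blast
  then obtain g2 z2 where g2: "(g2, z2) \<in> T" "\<beta> = \<Gamma>0 g2" by auto
  have "\<phi> = \<Gamma>0 (g1 + g2)" unfolding \<phi>_def g1 g2 T_add[OF g1(1) g2(1)] ..
  then obtain v where v: "(v, l *\<^sub>R v) \<in> T" "\<Gamma>0 v = \<phi>"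
    using \<Gamma>0_lift[OF l T_add(1)[OF g1(1) g2(1)]] by metis
  have "(\<phi>, \<Gamma>1 v) \<in> M l" unfolding M_iff using v by blast
  then have "(\<phi>, \<Gamma>1 v) \<in> closure (M l)" using closure_subset by blast
  then have \<Gamma>1v: "\<Gamma>1 v = R u" using N N\<phi> by simp
  have "(\<Gamma>1 (f0 + v), \<Gamma>0 (f0 + v)) \<in> B"
    using linear_operator_add[OF linB \<beta> Q[of u]] T_add[OF f0(1) v(1)] f0(2) v(2) \<Gamma>1v
    by (simp add: \<phi>_def add.commute)
  then have "(f0 + v, y0 + l *\<^sub>R v) \<in> ext B"
    using T_add(1)[OF f0(1) v(1)] by (simp add: boundary_extension_iff)
  moreover have "(y0 + l *\<^sub>R v) - l *\<^sub>R (f0 + v) = h" using f0(3) by (simp add: scaleR_add_right)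
  ultimately show ?thesis by blast
qed

text \<open>
  Below the form bound of \<open>A1\<close> one also has \<open>dom T = dom A1 + ker (T - l)\<close>, so \<open>\<Gamma>1\<close> takes all its
  values on \<open>ker (T - l)\<close>. The range condition on \<open>B\<close> over \<open>ran \<Gamma>1\<close> thus follows from the one over
  \<open>ran M(l)\<close>.
\<close>

lemma range_\<Gamma>1_subset_range_M:
  assumes A1: "selfadjoint_operator (bdry_kernel_restriction T \<Gamma>1)"
    and c: "\<And>x y. (x, y) \<in> bdry_kernel_restriction T \<Gamma>1 \<Longrightarrow> c * (norm x)\<^sup>2 \<le> inner y x"
    and l: "l < c"
  shows "\<Gamma>1 ` Domain T \<subseteq> Range (M l)"
proof clarify
  fix f y assume f: "(f, y) \<in> T"
  obtain g z where "(g, z) \<in> bdry_kernel_restriction T \<Gamma>1" and eq: "z - l *\<^sub>R g = y - l *\<^sub>R f"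
    using selfadjoint_shift_onto[OF A1 c l] by blast
  then have g: "(g, z) \<in> T" "\<Gamma>1 g = 0" by (auto simp: bdry_kernel_restriction_iff)
  have "y - z = l *\<^sub>R (f - g)" using eq by (simp add: algebra_simps)
  then have "(f - g, l *\<^sub>R (f - g)) \<in> T" "\<Gamma>1 (f - g) = \<Gamma>1 f" using T_diff[OF f g(1)] g(2) by simp_all
  then have "(\<Gamma>0 (f - g), \<Gamma>1 f) \<in> M l" unfolding M_iff by metis
  then show "\<Gamma>1 f \<in> Range (M l)" by blast
qed

section \<open>Self-adjointness and lower bounds of the extensions\<close>

lemma ext_selfadjoint:
  assumes b: "b \<ge> 0"
    and linB: "linear_operator B"
    and symB: "\<And>x y u v. (x, y) \<in> B \<Longrightarrow> (u, v) \<in> B \<Longrightarrow> inner y u = inner x v"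
    and B: "\<And>x y. (x, y) \<in> B \<Longrightarrow> inner y x \<le> b * (norm x)\<^sup>2"
    and ran_sqrt: "\<And>l. l < m \<Longrightarrow> Range (sqrt_operator (closure (M l))) \<subseteq> Domain B"
    and ran_M: "\<And>l. l < m \<Longrightarrow> B `` Range (closure (M l)) \<subseteq> \<Gamma>0 ` Domain T"
    and ran_\<Gamma>1: "\<Gamma>1 ` Domain T \<subseteq> Domain B"
    and v: "B `` (\<Gamma>1 ` Domain T) \<subseteq> \<Gamma>0 ` Domain T \<or>
      selfadjoint_operator (bdry_kernel_restriction T \<Gamma>1) \<and> bounded_from_below (bdry_kernel_restriction T \<Gamma>1)"
  shows "selfadjoint_operator (ext B) \<and> bounded_from_below (ext B)"
proof -
  have "\<exists>c. \<forall>l<c. l < m \<longrightarrow> B `` (\<Gamma>1 ` Domain T) \<subseteq> \<Gamma>0 ` Domain T"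
    using v
  proof
    assume A1: "selfadjoint_operator (bdry_kernel_restriction T \<Gamma>1) \<and>
      bounded_from_below (bdry_kernel_restriction T \<Gamma>1)"
    then obtain c where c: "\<And>x y. (x, y) \<in> bdry_kernel_restriction T \<Gamma>1 \<Longrightarrow> c * (norm x)\<^sup>2 \<le> inner y x"
      unfolding bounded_from_below_def Re_cinner by blast
    have "B `` (\<Gamma>1 ` Domain T) \<subseteq> \<Gamma>0 ` Domain T" if l: "l < c" "l < m" for l
    proof -
      have "\<Gamma>1 ` Domain T \<subseteq> Range (M l)"
        using A1 by (intro range_\<Gamma>1_subset_range_M[OF _ c l(1)]) auto
      also have "\<dots> \<subseteq> Range (closure (M l))" using closure_subset[of "M l"] by blast
      finally show ?thesis using ran_M[OF l(2)] by blast
    qed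
    then show ?thesis by blast
  qed auto
  then obtain c where c: "\<And>l. l < c \<Longrightarrow> l < m \<Longrightarrow> B `` (\<Gamma>1 ` Domain T) \<subseteq> \<Gamma>0 ` Domain T" by blast
  have "\<forall>\<^sub>F l in at_bot. operator_norm (closure (M l)) < 1 / (b + 1)"
    using b by (intro order_tendstoD(2)[OF weyl_vanishes]) auto
  moreover have "\<forall>\<^sub>F l in at_bot. l < min c m" by (rule eventually_at_bot_dense[THEN iffD2]) blast
  ultimately have "\<forall>\<^sub>F l in at_bot. operator_norm (closure (M l)) < 1 / (b + 1) \<and> l < min c m"
    by (rule eventually_conj)
  then obtain l where l: "operator_norm (closure (M l)) < 1 / (b + 1)" "l < c" "l < m"
    using eventually_happens'[OF trivial_limit_at_bot_linorder] by (metis (no_types, lifting) min_less_iff_conj)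
  have "b * operator_norm (closure (M l)) \<le> b * (1 / (b + 1))" using l(1) b by (intro mult_left_mono) auto
  also have "\<dots> < 1" using b by (simp add: field_simps)
  finally have bn: "b * operator_norm (closure (M l)) < 1" .
  have "densely_defined (ext B)"
  proof -
    have "S \<subseteq> ext B" using linB by (intro S_subset_ext) (simp add: linear_operator_def)
    then have "closure (Domain S) \<subseteq> closure (Domain (ext B))" by (intro closure_mono) blast
    then show ?thesis using S by (auto simp: symmetric_operator_def densely_defined_def)
  qed
  then have "selfadjoint_operator (ext B)"
    by (rule selfadjoint_operatorI[OF ext_linear[OF linB] _ ext_symmetric[OF symB]
          ext_shift_onto[OF l(3) b bn linB symB B ran_sqrt[OF l(3)] ran_M[OF l(3)] ran_\<Gamma>1 c[OF l(2,3)]]])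
  moreover have "bounded_from_below (ext B)"
    unfolding bounded_from_below_def Re_cinner
    using ext_form_bound[OF l(3) b less_imp_le[OF bn] B] by (intro exI[of _ l]) blast
  ultimately show ?thesis by blast
qed

text \<open>
  At distance \<open>(b K) powr (1 / \<alpha>)\<close> below \<open>\<nu>\<close> the decay bound for the norm of \<open>M\<close> equals \<open>1 / b\<close>.
\<close>

lemma ext_form_bound_decay:
  assumes \<alpha>: "\<alpha> > 0" and \<nu>: "\<nu> \<le> m" and K: "K > 0"
    and decay: "\<And>l. l < \<nu> \<Longrightarrow> operator_norm (closure (M l)) \<le> K / (\<nu> - l) powr \<alpha>"
    and b: "b > 0" and B: "\<And>x y. (x, y) \<in> B \<Longrightarrow> inner y x \<le> b * (norm x)\<^sup>2"
    and f: "(f, y) \<in> ext B"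
  shows "(\<nu> - (b * K) powr (1 / \<alpha>)) * (norm f)\<^sup>2 \<le> inner y f"
proof (rule ext_form_bound[OF _ _ _ B f])
  let ?s = "(b * K) powr (1 / \<alpha>)"
  have bK: "b * K > 0" using b K by simp
  then have s: "?s > 0" by (intro powr_gt_zero[THEN iffD2]) auto
  then show "\<nu> - ?s < m" using \<nu> by linarith
  show "b \<ge> 0" using b by simp
  have "operator_norm (closure (M (\<nu> - ?s))) \<le> K / ?s powr \<alpha>" using decay[of "\<nu> - ?s"] s by simp
  also have "?s powr \<alpha> = b * K" using \<alpha> bK by (simp add: powr_powr)
  finally have "b * operator_norm (closure (M (\<nu> - ?s))) \<le> b * (K / (b * K))" using b by (intro mult_left_mono) auto
  also have "\<dots> = 1" using b K by simp
  finally show "b * operator_norm (closure (M (\<nu> - ?s))) \<le> 1" .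
qed

end

section \<open>Growth of the spectral bottom\<close>

lemma const_bigo_powr:
  fixes d p :: real
  assumes "p > 0"
  shows "(\<lambda>_. d) \<in> O[at_top](\<lambda>\<omega>. \<bar>\<omega>\<bar> powr p)"
proof (rule bigoI[of _ "\<bar>d\<bar>"])
  show "\<forall>\<^sub>F \<omega> in at_top. norm d \<le> \<bar>d\<bar> * norm (\<bar>\<omega>\<bar> powr p)"
    using eventually_ge_at_top[of 1]
  proof eventually_elim
    case (elim \<omega>)
    then have "1 \<le> \<bar>\<omega>\<bar> powr p" using assms by (simp add: ge_one_powr_ge_zero)
    then show ?case using mult_left_mono[of 1 "\<bar>\<omega>\<bar> powr p" "\<bar>d\<bar>"] by simp
  qed
qed

theorem corollary2p9:
  fixes S T :: "('h::complex_hilbert_space, 'h) graph"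
    and \<Gamma>0 \<Gamma>1 :: "'h \<Rightarrow> 'g::complex_hilbert_space"
    and B :: "('g, 'g) graph"
    and \<alpha> \<mu> C :: real
  defines "A0 \<equiv> bdry_kernel_restriction T \<Gamma>0"
    and "A1 \<equiv> bdry_kernel_restriction T \<Gamma>1"
    and "M \<equiv> weyl_function T \<Gamma>0 \<Gamma>1"
    and "Mcl \<equiv> \<lambda>l::real. closure (weyl_function T \<Gamma>0 \<Gamma>1 (complex_of_real l))"
    and "A \<equiv> \<lambda>\<omega>::real. boundary_extension T \<Gamma>0 \<Gamma>1 (scale_operator (complex_of_real \<omega>) B)"
  assumes S: "symmetric_operator S" "closed S"
    and triple: "quasi_boundary_triple S T \<Gamma>0 \<Gamma>1"
    and A0_below: "bounded_from_below A0"
    and M_bounded: "\<exists>l0\<in>resolvent_set A0. bounded_operator (M l0)"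
    and B: "selfadjoint_operator B" "bounded_from_above B"
    and i: "((\<lambda>l. operator_norm (Mcl l)) \<longlongrightarrow> 0) at_bot"
    and ii: "\<And>l. l < min_spectrum A0 \<Longrightarrow> Range (sqrt_operator (Mcl l)) \<subseteq> Domain B"
    and iii: "\<And>l. l < min_spectrum A0 \<Longrightarrow> B `` Range (Mcl l) \<subseteq> \<Gamma>0 ` Domain T"
    and iv: "\<Gamma>1 ` Domain T \<subseteq> Domain B"
    and v: "B `` (\<Gamma>1 ` Domain T) \<subseteq> \<Gamma>0 ` Domain T \<or>
            selfadjoint_operator A1 \<and> bounded_from_below A1"
    and \<alpha>: "0 < \<alpha>" "\<alpha> \<le> 1"
    and \<mu>: "\<mu> \<le> min_spectrum A0"
    and C: "0 < C"
    and decay: "\<And>l. l < \<mu> \<Longrightarrow> operator_norm (Mcl l) \<le> C / (\<mu> - l) powr \<alpha>"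
  shows "(\<forall>\<omega>\<ge>0. S \<subseteq> A \<omega> \<and> selfadjoint_operator (A \<omega>) \<and> bounded_from_below (A \<omega>)) \<and>
    (\<lambda>\<omega>. \<bar>min_spectrum (A \<omega>)\<bar>) \<in> O[at_top](\<lambda>\<omega>. \<bar>\<omega>\<bar> powr (1 / \<alpha>)) \<and>
    ((\<exists>C'>0. \<forall>l<min_spectrum A0.
        operator_norm (Mcl l) \<le> C' / (min_spectrum A0 - l) powr \<alpha>) \<longrightarrow>
      (\<lambda>\<omega>. max (min_spectrum A0 - min_spectrum (A \<omega>)) 0)
        \<in> O[at_right 0](\<lambda>\<omega>. \<bar>\<omega>\<bar> powr (1 / \<alpha>)))"
proof -
  have A0_sa: "selfadjoint_operator A0" using triple by (simp add: quasi_boundary_triple_def A0_def)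
  define m where "m = min_spectrum A0"
  have A0_ge: "m * (norm x)\<^sup>2 \<le> inner y x" if xy: "(x, y) \<in> A0" for x y
  proof (cases "x = 0")
    case False
    show ?thesis using le_min_spectrum_iff[OF A0_sa A0_below xy False, of m] xy by (auto simp: m_def)
  qed simp
  interpret semibounded_triple S T \<Gamma>0 \<Gamma>1 m
    using S triple A0_ge M_bounded i
    by unfold_locales (auto simp: A0_def M_def Mcl_def bdry_kernel_restriction_iff)
  define BS where "BS \<omega> = scale_operator (complex_of_real \<omega>) B" for \<omega> :: real
  have A: "A \<omega> = ext (BS \<omega>)" for \<omega> by (simp add: A_def BS_def)
  have linB: "linear_operator B" using B(1) by (simp add: selfadjoint_operator_def)
  have linBS: "linear_operator (BS \<omega>)" for \<omega> unfolding BS_def using linear_operator_scale[OF linB] .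
  have symBS: "inner y u = inner x v" if "(x, y) \<in> BS \<omega>" "(u, v) \<in> BS \<omega>" for x y u v \<omega>
    using that selfadjoint_operator_inner[OF B(1)] by (auto simp: BS_def scale_operator_iff)
  obtain b where b: "b > 0" and Bb: "\<And>x y. (x, y) \<in> B \<Longrightarrow> inner y x \<le> b * (norm x)\<^sup>2"
  proof -
    obtain c where c: "\<And>x y. (x, y) \<in> B \<Longrightarrow> inner y x \<le> c * (norm x)\<^sup>2"
      using B(2) unfolding bounded_from_above_def Re_cinner by blast
    \<comment> \<open>A positive upper bound is needed for the powers of \<open>b * K\<close> below.\<close>
    have "inner y x \<le> max c 1 * (norm x)\<^sup>2" if "(x, y) \<in> B" for x y
      using c[OF that] mult_right_mono[of c "max c 1" "(norm x)\<^sup>2"] by simp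
    then show thesis using that[of "max c 1"] by simp
  qed
  have BSb: "inner y x \<le> \<omega> * b * (norm x)\<^sup>2" if "\<omega> \<ge> 0" "(x, y) \<in> BS \<omega>" for x y \<omega>
    using that Bb mult_left_mono[OF Bb that(1)] by (fastforce simp: BS_def scale_operator_iff mult.assoc)
  have DBS: "Domain (BS \<omega>) = Domain B" for \<omega> unfolding BS_def set_eq_iff Domain_iff scale_operator_iff by blast
  have scale\<Gamma>0: "r *\<^sub>R \<phi> \<in> \<Gamma>0 ` Domain T" if \<phi>: "\<phi> \<in> \<Gamma>0 ` Domain T" for r \<phi>
  proof -
    obtain f y where f: "(f, y) \<in> T" "\<phi> = \<Gamma>0 f" using \<phi> by auto
    from T_add_scaleR[OF T_zero(1) f(1), of r] f(2) show ?thesis by (force simp: T_zero image_iff)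
  qed
  have imBS: "BS \<omega> `` X \<subseteq> \<Gamma>0 ` Domain T" if "B `` X \<subseteq> \<Gamma>0 ` Domain T" for X \<omega>
  proof
    fix y assume "y \<in> BS \<omega> `` X"
    then obtain x z where "x \<in> X" "(x, z) \<in> B" "y = \<omega> *\<^sub>R z" by (auto simp: BS_def scale_operator_iff)
    then show "y \<in> \<Gamma>0 ` Domain T" using that scale\<Gamma>0 by blast
  qed
  have sa: "selfadjoint_operator (A \<omega>) \<and> bounded_from_below (A \<omega>)" if \<omega>: "\<omega> \<ge> 0" for \<omega>
    unfolding A
  proof (rule ext_selfadjoint[OF _ linBS symBS BSb[OF \<omega>]])
    show "\<omega> * b \<ge> 0" using \<omega> b by simp
    show "Range (sqrt_operator (closure (weyl_function T \<Gamma>0 \<Gamma>1 (complex_of_real l)))) \<subseteq> Domain (BS \<omega>)" if "l < m" for l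
      using ii[of l] that unfolding DBS m_def Mcl_def by simp
    show "BS \<omega> `` Range (closure (weyl_function T \<Gamma>0 \<Gamma>1 (complex_of_real l))) \<subseteq> \<Gamma>0 ` Domain T" if "l < m" for l
      using iii[of l] that unfolding m_def Mcl_def by (intro imBS) simp
    show "\<Gamma>1 ` Domain T \<subseteq> Domain (BS \<omega>)" using iv unfolding DBS .
    show "BS \<omega> `` (\<Gamma>1 ` Domain T) \<subseteq> \<Gamma>0 ` Domain T \<or>
      selfadjoint_operator (bdry_kernel_restriction T \<Gamma>1) \<and> bounded_from_below (bdry_kernel_restriction T \<Gamma>1)"
      using v imBS unfolding A1_def by blast
  qed
  have SA: "S \<subseteq> A \<omega>" for \<omega>
    unfolding A using linBS by (intro S_subset_ext) (simp add: linear_operator_def)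
  have part1: "\<forall>\<omega>\<ge>0. S \<subseteq> A \<omega> \<and> selfadjoint_operator (A \<omega>) \<and> bounded_from_below (A \<omega>)"
    using SA sa by blast
  define p where "p = 1 / \<alpha>"
  have p: "p > 0" using \<alpha> by (simp add: p_def)
  \<comment> \<open>In the trivial space the spectrum is empty and its minimum is an unspecified constant.\<close>
  show ?thesis
  proof (cases "\<exists>x y. (x, y) \<in> S \<and> x \<noteq> 0")
    case False
    have triv: "x = 0" for x :: 'h
    proof -
      have "closure (Domain S) \<subseteq> closure {0}" using False by (intro closure_mono) auto
      then show ?thesis using S(1) by (auto simp: symmetric_operator_def densely_defined_def)
    qed
    have Aeq: "A \<omega> = {(0, 0)}" for \<omega>
    proof -
      have "(0, 0) \<in> A \<omega>" unfolding A using ext_linear[OF linBS] by (simp add: linear_operator_def)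
      moreover have "q = (0, 0)" if "q \<in> A \<omega>" for q using triv[of "fst q"] triv[of "snd q"] by (simp add: prod_eq_iff)
      ultimately show ?thesis by blast
    qed
    have A0eq: "bdry_kernel_restriction T \<Gamma>0 = {(0, 0)}"
    proof -
      have "(0, 0) \<in> bdry_kernel_restriction T \<Gamma>0" by (simp add: bdry_kernel_restriction_iff T_zero)
      moreover have "q = (0, 0)" if "q \<in> bdry_kernel_restriction T \<Gamma>0" for q
        using triv[of "fst q"] triv[of "snd q"] by (simp add: prod_eq_iff)
      ultimately show ?thesis by blast
    qed
    show ?thesis
      using part1 const_bigo_powr[OF p] unfolding Aeq A0_def A0eq p_def by simp
  next
    case True
    then obtain x0 y0 where x0: "(x0, y0) \<in> S" "x0 \<noteq> 0" by blast
    \<comment> \<open>A Rayleigh quotient on \<open>dom S\<close>, which all extensions share.\<close>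
    define U where "U = inner y0 x0 / (norm x0)\<^sup>2"
    have le_iff: "c \<le> min_spectrum (A \<omega>) \<longleftrightarrow> (\<forall>(x, y)\<in>A \<omega>. c * (norm x)\<^sup>2 \<le> inner y x)" if "\<omega> \<ge> 0" for c \<omega>
      using le_min_spectrum_iff[of "A \<omega>" x0 y0 c] sa[OF that] x0 SA[of \<omega>] by blast
    have upper: "min_spectrum (A \<omega>) \<le> U" if \<omega>: "\<omega> \<ge> 0" for \<omega>
    proof -
      have "min_spectrum (A \<omega>) * (norm x0)\<^sup>2 \<le> inner y0 x0"
        using le_iff[OF \<omega>, of "min_spectrum (A \<omega>)"] x0 SA[of \<omega>] by blast
      then show ?thesis using x0(2) by (simp add: U_def field_simps)
    qed
    have lower: "\<nu> - (b * K) powr p * \<omega> powr p \<le> min_spectrum (A \<omega>)"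
      if \<omega>: "\<omega> > 0" and \<nu>: "\<nu> \<le> m" "K > 0"
        and d: "\<And>l. l < \<nu> \<Longrightarrow> operator_norm (Mcl l) \<le> K / (\<nu> - l) powr \<alpha>" for \<nu> K \<omega>
    proof -
      have "(\<nu> - (\<omega> * b * K) powr (1 / \<alpha>)) * (norm x)\<^sup>2 \<le> inner y x" if "(x, y) \<in> A \<omega>" for x y
        by (rule ext_form_bound_decay[OF \<alpha>(1) \<nu> d[unfolded Mcl_def] _ BSb])
          (use \<omega> b that in \<open>auto simp: A\<close>)
      then have "\<nu> - (\<omega> * b * K) powr (1 / \<alpha>) \<le> min_spectrum (A \<omega>)" using le_iff[of \<omega>] \<omega> by auto
      also have "(\<omega> * b * K) powr (1 / \<alpha>) = (b * K) powr p * \<omega> powr p"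
        using \<omega> b \<nu> by (simp add: p_def powr_mult mult.assoc mult.commute)
      finally show ?thesis .
    qed
    have a: "(\<lambda>\<omega>. \<bar>min_spectrum (A \<omega>)\<bar>) \<in> O[at_top](\<lambda>\<omega>. \<bar>\<omega>\<bar> powr p)"
    proof -
      have "(\<lambda>\<omega>. \<bar>min_spectrum (A \<omega>)\<bar>) \<in> O[at_top](\<lambda>\<omega>. (\<bar>\<mu>\<bar> + \<bar>U\<bar>) + (b * C) powr p * \<bar>\<omega>\<bar> powr p)"
      proof (rule bigoI[of _ 1])
        show "\<forall>\<^sub>F \<omega> in at_top. norm \<bar>min_spectrum (A \<omega>)\<bar>
            \<le> 1 * norm ((\<bar>\<mu>\<bar> + \<bar>U\<bar>) + (b * C) powr p * \<bar>\<omega>\<bar> powr p)"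
          using eventually_gt_at_top[of 0]
        proof eventually_elim
          case (elim \<omega>)
          have "(b * C) powr p * \<omega> powr p \<ge> 0" by simp
          then have "\<bar>min_spectrum (A \<omega>)\<bar> \<le> \<bar>\<mu>\<bar> + \<bar>U\<bar> + (b * C) powr p * \<omega> powr p"
            using lower[OF elim \<mu>[folded m_def] C decay] upper[of \<omega>] elim by linarith
          then show ?case using elim by simp
        qed
      qed
      also have "(\<lambda>\<omega>. (\<bar>\<mu>\<bar> + \<bar>U\<bar>) + (b * C) powr p * \<bar>\<omega>\<bar> powr p) \<in> O[at_top](\<lambda>\<omega>. \<bar>\<omega>\<bar> powr p)"
        by (intro sum_in_bigo const_bigo_powr p) simp
      finally show ?thesis .
    qed
    have "(\<lambda>\<omega>. max (m - min_spectrum (A \<omega>)) 0) \<in> O[at_right 0](\<lambda>\<omega>. \<bar>\<omega>\<bar> powr p)"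
      if C': "C' > 0" "\<And>l. l < m \<Longrightarrow> operator_norm (Mcl l) \<le> C' / (m - l) powr \<alpha>" for C'
    proof (rule bigoI[of _ "(b * C') powr p"])
      show "\<forall>\<^sub>F \<omega> in at_right 0. norm (max (m - min_spectrum (A \<omega>)) 0) \<le> (b * C') powr p * norm (\<bar>\<omega>\<bar> powr p)"
        using eventually_at_right_less[of 0]
      proof eventually_elim
        case (elim \<omega>)
        have "(b * C') powr p * \<omega> powr p \<ge> 0" by simp
        then show ?case using lower[OF elim order_refl C'] elim by simp
      qed
    qed
    then show ?thesis using part1 a unfolding m_def p_def by blast
  qed
qed

end
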